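(* Consider $f(x)=\frac1n\sum_{i=1}^n f_i(x)$, $x\in\mathbb{R}^d$. Assume there exists $f_*\in\mathbb{R}$ with $f(x)\ge f_*$ for all $x\in\mathbb{R}^d$; that $f_i$ is $L_i$-smooth for all $i\in\{1,\dots,n\}$, i.e. $\|\nabla f_i(x)-\nabla f_i(y)\|\le L_i\|x-y\|$ for all $x,y\in\mathbb{R}^d$; and that $f$ satisfies the Polyak–Łojasiewicz condition with parameter $\mu$, i.e. $\|\nabla f(x)\|^2\ge2\mu(f(x)-f(x^* ))$ for all $x\in\mathbb{R}^d$, where $x^*=\arg\min_{x\in\mathbb{R}^d}f(x)$. Put $L^2=\frac1n\sum_{i=1}^nL_i^2$ and $\Delta_0=f(x^0)-f(x^* )$. Let $\mathcal{Q}$ be a quantization operator with parameter $\omega$ and expected density $\zeta_{\mathcal Q}$, and let $p=\frac{\zeta_{\mathcal Q}r}{dn}$, where $r\le n$. If $$\gamma\le\min\left\{\frac{1}{L\left(1+\sqrt{\frac{2(1+\omega)}{r}\left(\frac{dn}{\zeta_{\mathcal Q}r}-1\right)}\right)},\frac{p}{2\mu}\right\},$$ then PP-MARINA requires $$K=\mathcal{O}\left(\max\left\{\frac{dn}{\zeta_{\mathcal Q}r},\frac L\mu\left(1+\sqrt{\frac{1+\omega}{r}\left(\frac{dn}{\zeta_{\mathcal Q}r}-1\right)}\right)\right\}\log\frac{\Delta_0}{\varepsilon}\right)$$ iterations/communication rounds to achieve $\mathbf{E}[f(x^K)-f(x^* )]\le\varepsilon$, and the expected total communication cost is $$\mathcal{O}\left(dn+\max\left\{dn,\frac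 L\mu\left(\zeta_{\mathcal Q}r+\sqrt{(1+\omega)\zeta_{\mathcal Q}(dn-\zeta_{\mathcal Q}r)}\right)\right\}\log\frac{\Delta_0}{\varepsilon}\right)$$ under an assumption that the communication cost is proportional to the number of non-zero components of transmitted vectors from workers to the server.
   Context: $\|\cdot\|$ is the Euclidean norm; $\|y\|_0$ is the number of non-zero components of $y\in\mathbb{R}^d$. The total communication cost is that of all workers together. Quantization operator: a stochastic mapping $\mathcal{Q}:\mathbb{R}^d\to\mathbb{R}^d$ for which there is $\omega>0$ with $\mathbf{E}[\mathcal{Q}(x)]=x$ and $\mathbf{E}[\|\mathcal{Q}(x)-x\|^2]\le\omega\|x\|^2$ for any $x\in\mathbb{R}^d$. Its expected density is $\zeta_{\mathcal Q}=\sup_{x\in\mathbb{R}^d}\mathbf{E}[\|\mathcal{Q}(x)\|_0]$. PP-MARINA (a distributed method with $n$ workers, worker $i$ having access to $f_i$, and a server; input: starting point $x^0$, stepsize $\gamma$, probability $p\in(0,1]$, number of iterations $K$, clients-batchsize $r\le n$): initialize $g^0=\nabla f(x^0)$. For $k=0,\dots,K-1$: sample $c_k\sim\mathrm{Bernoulli}(p)$; choose $I'_k=\{1,\dots,n\}$ if $c_k=1$, and choose $I'_k$ as the set of $r$ i.i.d. samples from the uniform distribution over $\{1,\dots,n\}$ otherwise; broadcast $g^k$ to all workers; each worker $i=1,\dots,n$ in parallel computes $x^{k+1}=x^k-\gamma g^k$ and sets $g_i^{k+1}=\nabla f_i(x^{k+1})$ if $c_k=1$, and $g_i^{k+1}=g^k+\mathcal{Q}(\nabla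 f_i(x^{k+1})-\nabla f_i(x^k))$ if $c_k=0$; then set $g^{k+1}=\nabla f(x^{k+1})$ if $c_k=1$, and $g^{k+1}=g^k+\frac1r\sum_{i_k\in I'_k}\mathcal{Q}(\nabla f_{i_k}(x^{k+1})-\nabla f_{i_k}(x^k))$ if $c_k=0$. The point considered here is the last iterate $x^K$.
   Formalization: The O-constants are 2/c and 4/c, where c in (0,1] is a lower bound for the ratio of γ to its upper bound (no uniform constant serves arbitrarily small γ); the communication cost bound is claimed only for ε ≤ Δ_0, where the logarithm is nonnegative. *)

theory Defs
  imports "HOL-Probability.Probability"
begin

definition grad :: "('a::euclidean_space \<Rightarrow> real) \<Rightarrow> 'a \<Rightarrow> 'a" where
  "grad f x = (THE D. GDERIV f x :> D)"

definition smooth_with :: "real \<Rightarrow> ('a::euclidean_space \<Rightarrow> real) \<Rightarrow> bool" where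
  "smooth_with L f \<longleftrightarrow>
     (\<forall>x. \<exists>D. GDERIV f x :> D) \<and>
     (\<forall>x y. norm (grad f x - grad f y) \<le> L * norm (x - y))"

definition polyak_lojasiewicz :: "real \<Rightarrow> ('a::euclidean_space \<Rightarrow> real) \<Rightarrow> 'a \<Rightarrow> bool" where
  "polyak_lojasiewicz \<mu> f xstar \<longleftrightarrow>
     (\<forall>x. (norm (grad f x))\<^sup>2 \<ge> 2 * \<mu> * (f x - f xstar))"

definition average :: "nat \<Rightarrow> (nat \<Rightarrow> 'a \<Rightarrow> real) \<Rightarrow> 'a \<Rightarrow> real" where
  "average n f x = 1 / real n * (\<Sum>i=1..n. f i x)"

definition nnz :: "real ^ 'd \<Rightarrow> real" where
  "nnz y = real (card {i. y $ i \<noteq> 0})"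

(* A stochastic mapping is a Markov kernel: Q x is the law of the random vector
   that the quantizer outputs on input x.  Integrability is required explicitly,
   since the Bochner integral of a non-integrable function is 0 by convention. *)
definition quantization :: "real \<Rightarrow> (real ^ 'd \<Rightarrow> (real ^ 'd) measure) \<Rightarrow> bool" where
  "quantization \<omega> Q \<longleftrightarrow>
     \<omega> > 0 \<and>
     Q \<in> borel \<rightarrow>\<^sub>M prob_algebra borel \<and>
     (\<forall>x. integrable (Q x) (\<lambda>y. y) \<and> (\<integral>y. y \<partial>Q x) = x) \<and>
     (\<forall>x. integrable (Q x) (\<lambda>y. (norm (y - x))\<^sup>2) \<and>
          (\<integral>y. (norm (y - x))\<^sup>2 \<partial>Q x) \<le> \<omega> * (norm x)\<^sup>2)"

definition expected_density :: "(real ^ 'd \<Rightarrow> (real ^ 'd) measure) \<Rightarrow> real" where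
  "expected_density Q = (SUP x. \<integral>y. nnz y \<partial>Q x)"

(* One iteration, as a kernel on triples (x, g, s): the iterate, the server's
   gradient estimator, and the number of non-zero components sent so far by all
   workers to the server.  If the coin shows True, each of the n workers sends
   its full gradient.  Otherwise J lists the r i.i.d. uniform clients, and the
   product measure makes the r quantized differences independent given J (a
   client that is drawn twice sends two independent messages). *)
definition pp_marina_step ::
  "nat \<Rightarrow> nat \<Rightarrow> real \<Rightarrow> real \<Rightarrow> (real ^ 'd \<Rightarrow> (real ^ 'd) measure) \<Rightarrow> (nat \<Rightarrow> real ^ 'd \<Rightarrow> real)
   \<Rightarrow> ((real ^ 'd) \<times> (real ^ 'd) \<times> real) \<Rightarrow> ((real ^ 'd) \<times> (real ^ 'd) \<times> real) measure" where
  "pp_marina_step n r p \<gamma> Q f = (\<lambda>(x, g, s).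
     let x' = x - \<gamma> *\<^sub>R g in
     measure_pmf (bernoulli_pmf p) \<bind> (\<lambda>c.
       if c then
         return borel (x', grad (average n f) x', s + (\<Sum>i=1..n. nnz (grad (f i) x')))
       else
         measure_pmf (replicate_pmf r (pmf_of_set {1..n})) \<bind> (\<lambda>J.
         PiM {..<r} (\<lambda>j. Q (grad (f (J ! j)) x' - grad (f (J ! j)) x)) \<bind> (\<lambda>q.
         return borel (x', g + (1 / real r) *\<^sub>R (\<Sum>j<r. q j), s + (\<Sum>j<r. nnz (q j)))))))"

(* Joint law of (x, g, s) after k iterations.  The initial count is that of the
   gradients the server needs to form its first estimator. *)
primrec pp_marina ::
  "nat \<Rightarrow> nat \<Rightarrow> real \<Rightarrow> real \<Rightarrow> (real ^ 'd \<Rightarrow> (real ^ 'd) measure) \<Rightarrow> (nat \<Rightarrow> real ^ 'd \<Rightarrow> real)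
   \<Rightarrow> real ^ 'd \<Rightarrow> nat \<Rightarrow> ((real ^ 'd) \<times> (real ^ 'd) \<times> real) measure" where
  "pp_marina n r p \<gamma> Q f x0 0 =
     return borel (x0, grad (average n f) x0, \<Sum>i=1..n. nnz (grad (f i) x0))"
| "pp_marina n r p \<gamma> Q f x0 (Suc k) =
     pp_marina n r p \<gamma> Q f x0 k \<bind> pp_marina_step n r p \<gamma> Q f"

end

theory Submission
  imports Defs
begin

text \<open>
  Write \<open>e = \<parallel>g - \<nabla>F x\<parallel>\<^sup>2\<close>. Along one step the estimator error satisfies
  \<open>E e' \<le> (1 - p) (e + (1 + \<omega>) L\<^sup>2 / r \<parallel>x' - x\<parallel>\<^sup>2)\<close>: given the sampled clients the quantization
  noises are independent and centred, and the sampled gradient differences are themselves i.i.d.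
  with mean \<open>\<nabla>F x' - \<nabla>F x\<close>, so both contributions to the variance are divided by \<open>r\<close>.
  Combined with the descent inequality for \<open>F\<close> and the Polyak-Lojasiewicz condition, the
  Lyapunov function \<open>F x - F x* + \<gamma> / p e\<close> contracts in expectation by the factor
  \<open>1 - \<gamma> \<mu>\<close>; the condition on \<open>\<gamma>\<close> makes the coefficient of \<open>\<parallel>x' - x\<parallel>\<^sup>2\<close> nonpositive. A step
  costs at most \<open>p d n + (1 - p) r \<zeta> \<le> 2 \<zeta> r\<close> non-zero components in expectation.
  Expectations are taken as nonnegative Lebesgue integrals throughout, which makes integrability a
  consequence of the bounds.
\<close>

section \<open>Kernels and variances\<close>

text \<open>Boxes form an intersection-stable generator of the product sigma-algebra, and the mass
  of a box is a finite product of masses, each measurable in \<open>x\<close> because every factor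
  is a kernel.\<close>

lemma measurable_PiM_prob_algebra:
  assumes I: "finite I" and K: "\<And>i. i \<in> I \<Longrightarrow> K i \<in> M \<rightarrow>\<^sub>M prob_algebra (N i)"
  shows "(\<lambda>x. PiM I (\<lambda>i. K i x)) \<in> M \<rightarrow>\<^sub>M prob_algebra (PiM I N)"
proof -
  have K': "sets (K i x) = sets (N i)" "prob_space (K i x)" if "i \<in> I" "x \<in> space M" for i x
    using measurable_space[OF K[OF that(1)] that(2)] by (auto simp: space_prob_algebra)
  show ?thesis
  proof (rule measurable_prob_algebra_generated[OF sets_PiM Int_stable_prod_algebra prod_algebra_sets_into_space])
    fix x assume x: "x \<in> space M"
    show "prob_space (PiM I (\<lambda>i. K i x))"
      using K' x by (intro prob_space_PiM) auto
    show "sets (PiM I (\<lambda>i. K i x)) = sets (PiM I N)"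
      using K' x by (intro sets_PiM_cong) auto
  next
    fix A assume "A \<in> prod_algebra I N"
    then obtain E where A: "A = Pi\<^sub>E I E" and E: "E \<in> (\<Pi> i\<in>I. sets (N i))"
      by (rule prod_algebraE_all)
    have "emeasure (PiM I (\<lambda>i. K i x)) A = (\<Prod>i\<in>I. emeasure (K i x) (E i))" if x: "x \<in> space M" for x
    proof -
      \<comment> \<open>\<open>product_sigma_finite\<close> constrains every index, while nothing is
        known of \<open>K i x\<close> off \<open>I\<close>. Any sigma-finite measure serves there,
        since \<open>PiM I\<close> only sees the indices in \<open>I\<close>.\<close>
      define K' where "K' i = (if i \<in> I then K i x else count_space {undefined})" for i
      have "product_sigma_finite K'"
        using K' x unfolding K'_def product_sigma_finite_def
        by (auto intro!: prob_space_imp_sigma_finite sigma_finite_measure_count_space_finite)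
      then have "emeasure (PiM I K') (Pi\<^sub>E I E) = (\<Prod>i\<in>I. emeasure (K' i) (E i))"
        using E K' x by (intro product_sigma_finite.emeasure_PiM I) (auto simp: K'_def)
      moreover have "PiM I K' = PiM I (\<lambda>i. K i x)"
        by (intro PiM_cong) (auto simp: K'_def)
      ultimately show ?thesis by (simp add: A K'_def)
    qed
    moreover have "(\<lambda>x. \<Prod>i\<in>I. emeasure (K i x) (E i)) \<in> borel_measurable M"
      using E by (intro borel_measurable_prod_ennreal
          measurable_compose[OF measurable_prob_algebraD[OF K] measurable_emeasure_subprob_algebra]) auto
    ultimately show "(\<lambda>x. emeasure (PiM I (\<lambda>i. K i x)) A) \<in> borel_measurable M"
      by (simp cong: measurable_cong)
  qed
qed

text \<open>The mass of a set under the mixture is a finite weighted sum of its masses under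
  \<open>K y x\<close>. Measurability in \<open>x\<close> is therefore asked for on the support
  only, whereas every \<open>K y x\<close> has to be a probability measure for the bind to be well
  formed.\<close>

lemma measurable_bind_pmf_finite:
  assumes fin: "finite (set_pmf q)"
    and K: "\<And>y. y \<in> set_pmf q \<Longrightarrow> K y \<in> M \<rightarrow>\<^sub>M prob_algebra N"
    and space: "\<And>y x. x \<in> space M \<Longrightarrow> K y x \<in> space (prob_algebra N)"
  shows "(\<lambda>x. measure_pmf q \<bind> (\<lambda>y. K y x)) \<in> M \<rightarrow>\<^sub>M prob_algebra N"
proof -
  have q: "measure_pmf q \<in> space (prob_algebra (count_space UNIV))"
    by (simp add: space_prob_algebra measure_pmf.prob_space_axioms)
  have K': "(\<lambda>y. K y x) \<in> count_space UNIV \<rightarrow>\<^sub>M prob_algebra N" if "x \<in> space M" for x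
    using space[OF that] by simp
  show ?thesis
  proof (rule measurable_prob_algebra_generated[OF sets.sigma_sets_eq[symmetric] sets.Int_stable sets.space_closed])
    fix A assume A: "A \<in> sets N"
    have "emeasure (measure_pmf q \<bind> (\<lambda>y. K y x)) A = (\<Sum>y\<in>set_pmf q. emeasure (K y x) A * pmf q y)"
      if "x \<in> space M" for x
      using emeasure_bind_prob_algebra[OF q K' A] that fin by (simp add: nn_integral_measure_pmf_finite)
    moreover have "(\<lambda>x. \<Sum>y\<in>set_pmf q. emeasure (K y x) A * pmf q y) \<in> borel_measurable M"
      using A by (intro borel_measurable_sum borel_measurable_times_ennreal borel_measurable_const
        measurable_compose[OF measurable_prob_algebraD[OF K] measurable_emeasure_subprob_algebra]) auto
    ultimately show "(\<lambda>x. emeasure (measure_pmf q \<bind> (\<lambda>y. K y x)) A) \<in> borel_measurable M"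
      by (simp cong: measurable_cong)
  qed (use prob_space_bind'[OF q K'] sets_bind'[OF q K'] in auto)
qed

section \<open>Second moments of sums of independent centred vectors\<close>

lemma bias_variance:
  fixes X :: "'a \<Rightarrow> 'b::euclidean_space"
  assumes "prob_space M" and X: "integrable M X" and m: "(\<integral>x. X x \<partial>M) = m"
    and var: "integrable M (\<lambda>x. (norm (X x - m))\<^sup>2)"
  shows "integrable M (\<lambda>x. (norm (b + (X x - m)))\<^sup>2)"
    and "(\<integral>x. (norm (b + (X x - m)))\<^sup>2 \<partial>M) = (norm b)\<^sup>2 + (\<integral>x. (norm (X x - m))\<^sup>2 \<partial>M)"
proof -
  have eq: "(norm (b + (X x - m)))\<^sup>2 = (norm b)\<^sup>2 + 2 * (b \<bullet> (X x - m)) + (norm (X x - m))\<^sup>2" for x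
    by (simp add: power2_norm_eq_inner inner_add_left inner_add_right inner_commute)
  have fin: "finite_measure M" and one: "measure M (space M) = 1"
    using assms(1) by (simp_all add: prob_space.finite_measure prob_space.prob_space)
  note const [simp] = finite_measure.integrable_const[OF fin]
  have int: "integrable M (\<lambda>x. b \<bullet> (X x - m))"
    using X by (intro integrable_inner_right Bochner_Integration.integrable_diff const) auto
  show "integrable M (\<lambda>x. (norm (b + (X x - m)))\<^sup>2)"
    unfolding eq using int var by auto
  \<comment> \<open>The cross term of the expanded square vanishes because \<open>X - m\<close> is
    centred.\<close>
  have "(\<integral>x. b \<bullet> (X x - m) \<partial>M) = b \<bullet> ((\<integral>x. X x \<partial>M) - m)"
    using X by (subst integral_inner_right) (auto simp: one)
  then show "(\<integral>x. (norm (b + (X x - m)))\<^sup>2 \<partial>M) = (norm b)\<^sup>2 + (\<integral>x. (norm (X x - m))\<^sup>2 \<partial>M)"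
    unfolding eq using int var m by (simp add: one)
qed

text \<open>One coordinate is split off and integrated first. The others are then a fixed offset, to
  whose squared norm \<open>bias_variance\<close> adds the variance of the new coordinate; no cross
  terms survive, so the variances add up.\<close>

lemma nn_integral_PiM_norm_sum_sq:
  fixes M :: "'i \<Rightarrow> 'b::euclidean_space measure"
  assumes "finite I" and M: "\<And>i. prob_space (M i)" "\<And>i. sets (M i) = sets borel"
    and mean: "\<And>i. integrable (M i) (\<lambda>y. y)" "\<And>i. (\<integral>y. y \<partial>M i) = m i"
    and var: "\<And>i. integrable (M i) (\<lambda>y. (norm (y - m i))\<^sup>2)"
  shows "(\<integral>\<^sup>+q. ennreal ((norm (b + (\<Sum>i\<in>I. c *\<^sub>R (q i - m i))))\<^sup>2) \<partial>PiM I M) =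
    ennreal ((norm b)\<^sup>2 + c\<^sup>2 * (\<Sum>i\<in>I. \<integral>y. (norm (y - m i))\<^sup>2 \<partial>M i))"
  using assms(1)
proof (induction I arbitrary: b)
  case empty
  then show ?case by (simp add: PiM_empty nn_integral_count_space_finite)
next
  case (insert i I)
  have M': "product_sigma_finite M"
    using M(1) by (simp add: product_sigma_finite_def prob_space_imp_sigma_finite)
  note [measurable_cong] = M(2)
  let ?V = "\<lambda>i. \<integral>y. (norm (y - m i))\<^sup>2 \<partial>M i"
  have inner: "(\<integral>\<^sup>+y. ennreal ((norm (a + c *\<^sub>R (y - m i)))\<^sup>2) \<partial>M i) = ennreal ((norm a)\<^sup>2) + ennreal (c\<^sup>2 * ?V i)" for a
  proof -
    have sc: "c *\<^sub>R (y - m i) = c *\<^sub>R y - c *\<^sub>R m i" for y by (simp add: algebra_simps)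
    have n: "(norm (c *\<^sub>R y - c *\<^sub>R m i))\<^sup>2 = c\<^sup>2 * (norm (y - m i))\<^sup>2" for y
      by (simp add: sc[symmetric] power_mult_distrib)
    have 1: "integrable (M i) (\<lambda>y. (norm (a + (c *\<^sub>R y - c *\<^sub>R m i)))\<^sup>2)"
      and 2: "(\<integral>y. (norm (a + (c *\<^sub>R y - c *\<^sub>R m i)))\<^sup>2 \<partial>M i) =
         (norm a)\<^sup>2 + (\<integral>y. (norm (c *\<^sub>R y - c *\<^sub>R m i))\<^sup>2 \<partial>M i)"
      using bias_variance[OF M(1)[of i], of "\<lambda>y. c *\<^sub>R y" "c *\<^sub>R m i" a] mean var[of i] by (auto simp: n)
    have "(\<integral>\<^sup>+y. ennreal ((norm (a + c *\<^sub>R (y - m i)))\<^sup>2) \<partial>M i) = ennreal ((norm a)\<^sup>2 + c\<^sup>2 * ?V i)"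
      using 1 2 by (subst nn_integral_eq_integral) (auto simp: sc n)
    then show ?thesis by (simp add: ennreal_plus)
  qed
  have "(\<integral>\<^sup>+q. ennreal ((norm (b + (\<Sum>i\<in>insert i I. c *\<^sub>R (q i - m i))))\<^sup>2) \<partial>PiM (insert i I) M) =
    (\<integral>\<^sup>+q. \<integral>\<^sup>+y. ennreal ((norm (b + (\<Sum>j\<in>insert i I. c *\<^sub>R ((q(i := y)) j - m j))))\<^sup>2) \<partial>M i \<partial>PiM I M)"
    using insert.hyps by (intro product_sigma_finite.product_nn_integral_insert[OF M']) measurable
  also have "\<dots> = (\<integral>\<^sup>+q. \<integral>\<^sup>+y. ennreal ((norm ((b + (\<Sum>j\<in>I. c *\<^sub>R (q j - m j))) + c *\<^sub>R (y - m i)))\<^sup>2) \<partial>M i \<partial>PiM I M)"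
  proof (intro nn_integral_cong)
    fix q y
    have "(\<Sum>j\<in>I. c *\<^sub>R ((q(i := y)) j - m j)) = (\<Sum>j\<in>I. c *\<^sub>R (q j - m j))"
      using insert.hyps by (intro sum.cong) auto
    then show "ennreal ((norm (b + (\<Sum>j\<in>insert i I. c *\<^sub>R ((q(i := y)) j - m j))))\<^sup>2) =
      ennreal ((norm ((b + (\<Sum>j\<in>I. c *\<^sub>R (q j - m j))) + c *\<^sub>R (y - m i)))\<^sup>2)"
      using insert.hyps by (simp add: ac_simps)
  qed
  also have "\<dots> = ennreal ((norm b)\<^sup>2 + c\<^sup>2 * (\<Sum>i\<in>I. ?V i)) + ennreal (c\<^sup>2 * ?V i)"
  proof -
    have "prob_space (PiM I M)" using M(1) by (intro prob_space_PiM) auto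
    then show ?thesis
      unfolding inner by (subst nn_integral_add) (auto simp: insert.IH prob_space.emeasure_space_1)
  qed
  also have "\<dots> = ennreal ((norm b)\<^sup>2 + c\<^sup>2 * (\<Sum>i\<in>insert i I. ?V i))"
    using insert.hyps by (subst ennreal_plus[symmetric])
      (auto intro!: add_nonneg_nonneg mult_nonneg_nonneg sum_nonneg simp: algebra_simps)
  finally show ?case .
qed

text \<open>The counterpart for i.i.d. draws from a list distribution. The first draw is absorbed
  into the offset, which is why the induction runs over all \<open>b\<close>.\<close>

lemma nn_integral_replicate_pmf_norm_sum_sq:
  fixes h :: "'i \<Rightarrow> 'b::euclidean_space"
  assumes fin: "finite (set_pmf P)" and mean: "(\<integral>i. h i \<partial>measure_pmf P) = m"
  shows "(\<integral>\<^sup>+J. ennreal ((norm (b + (\<Sum>j<r. c *\<^sub>R (h (J ! j) - m))))\<^sup>2) \<partial>measure_pmf (replicate_pmf r P)) =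
    ennreal ((norm b)\<^sup>2 + real r * c\<^sup>2 * (\<integral>i. (norm (h i - m))\<^sup>2 \<partial>measure_pmf P))"
proof (induction r arbitrary: b)
  case 0
  then show ?case by simp
next
  case (Suc r)
  let ?V = "\<integral>i. (norm (h i - m))\<^sup>2 \<partial>measure_pmf P"
  have n: "(norm (c *\<^sub>R h i - c *\<^sub>R m))\<^sup>2 = c\<^sup>2 * (norm (h i - m))\<^sup>2" for i
    by (simp add: scaleR_right_diff_distrib[symmetric] power_mult_distrib)
  \<comment> \<open>The constant \<open>x\<close> will be the variance already collected from the
    remaining draws.\<close>
  have inner: "(\<integral>\<^sup>+i. ennreal ((norm (b + c *\<^sub>R (h i - m)))\<^sup>2 + x) \<partial>measure_pmf P) = ennreal ((norm b)\<^sup>2 + c\<^sup>2 * ?V + x)"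
    if "x \<ge> 0" for x
  proof -
    have 1: "integrable (measure_pmf P) (\<lambda>i. c *\<^sub>R h i)"
      and 2: "integrable (measure_pmf P) (\<lambda>i. (norm (c *\<^sub>R h i - c *\<^sub>R m))\<^sup>2)"
      and 3: "integrable (measure_pmf P) (\<lambda>i. (norm (b + (c *\<^sub>R h i - c *\<^sub>R m)))\<^sup>2)"
      by (auto intro: integrable_measure_pmf_finite[OF fin])
    have "measure_pmf.expectation P (\<lambda>i. c *\<^sub>R h i) = c *\<^sub>R m"
      by (simp add: mean)
    from bias_variance(2)[OF measure_pmf.prob_space_axioms 1 this 2, of b] 3 show ?thesis
      using that by (subst nn_integral_eq_integral)
        (auto simp: measure_pmf.prob_space n scaleR_right_diff_distrib)
  qed
  have "(\<integral>\<^sup>+J. ennreal ((norm (b + (\<Sum>j<Suc r. c *\<^sub>R (h (J ! j) - m))))\<^sup>2) \<partial>measure_pmf (replicate_pmf (Suc r) P)) =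
    (\<integral>\<^sup>+i. \<integral>\<^sup>+J. ennreal ((norm ((b + c *\<^sub>R (h i - m)) + (\<Sum>j<r. c *\<^sub>R (h (J ! j) - m))))\<^sup>2)
       \<partial>measure_pmf (replicate_pmf r P) \<partial>measure_pmf P)"
    by (simp add: lessThan_Suc_eq_insert_0 sum.reindex zero_notin_Suc_image ac_simps)
  also have "\<dots> = ennreal ((norm b)\<^sup>2 + real (Suc r) * c\<^sup>2 * ?V)"
    unfolding Suc.IH by (subst inner) (auto simp: algebra_simps)
  finally show ?case .
qed

lemma nn_integral_replicate_pmf_sum:
  "(\<integral>\<^sup>+J. (\<Sum>j<r. u (J ! j)) \<partial>measure_pmf (replicate_pmf r P)) = of_nat r * (\<integral>\<^sup>+i. u i \<partial>measure_pmf P)"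
proof (induction r)
  case (Suc r)
  then show ?case
    by (simp add: lessThan_Suc_eq_insert_0 sum.reindex zero_notin_Suc_image nn_integral_add
        measure_pmf.emeasure_space_1 distrib_right)
qed simp

lemma nn_integral_PiM_component:
  assumes i: "i \<in> I" and M: "\<And>i. i \<in> I \<Longrightarrow> prob_space (M i)" and h: "h \<in> borel_measurable (M i)"
  shows "(\<integral>\<^sup>+q. h (q i) \<partial>PiM I M) = (\<integral>\<^sup>+y. h y \<partial>M i)"
proof -
  have "(\<integral>\<^sup>+y. h y \<partial>distr (PiM I M) (M i) (\<lambda>q. q i)) = (\<integral>\<^sup>+q. h (q i) \<partial>PiM I M)"
    using i h by (intro nn_integral_distr) auto
  moreover have "distr (PiM I M) (M i) (\<lambda>q. q i) = M i"
    using M i by (rule distr_PiM_component)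
  ultimately show ?thesis by simp
qed

text \<open>The way back from nonnegative integrals: a single bound on the absolute value delivers
  both integrability and the bound on the Bochner integral.\<close>

lemma integral_le_of_nn_integral_le:
  fixes h :: "'a \<Rightarrow> real"
  assumes h: "h \<in> borel_measurable M" and le: "(\<integral>\<^sup>+x. ennreal \<bar>h x\<bar> \<partial>M) \<le> ennreal B" and B: "0 \<le> B"
  shows "integrable M h" and "(\<integral>x. h x \<partial>M) \<le> B"
proof -
  show int: "integrable M h"
    unfolding integrable_iff_bounded using h le by (auto simp: order_le_less_trans)
  then have "ennreal (\<integral>x. \<bar>h x\<bar> \<partial>M) \<le> ennreal B"
    using le by (subst (asm) nn_integral_eq_integral) auto
  then have "(\<integral>x. \<bar>h x\<bar> \<partial>M) \<le> B"
    using B by simp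
  then show "(\<integral>x. h x \<partial>M) \<le> B"
    using integral_abs_bound[of M h] by linarith
qed

section \<open>Smooth functions\<close>

lemma grad_eqI: "GDERIV f x :> D \<Longrightarrow> grad f x = D"
  unfolding grad_def
proof (rule the_equality)
  fix E assume "GDERIV f x :> D" "GDERIV f x :> E"
  then have "(\<lambda>h. h \<bullet> D) = (\<lambda>h. h \<bullet> E)"
    unfolding gderiv_def by (rule has_derivative_unique)
  then show "E = D"
    by (metis inner_commute vector_eq_ldot)
qed

lemma smooth_with_GDERIV: "smooth_with L f \<Longrightarrow> GDERIV f x :> grad f x"
  using grad_eqI unfolding smooth_with_def by metis

lemma smooth_with_lipschitz: "smooth_with L f \<Longrightarrow> norm (grad f x - grad f y) \<le> L * norm (x - y)"
  unfolding smooth_with_def by blast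

lemma smooth_with_continuous: "smooth_with L f \<Longrightarrow> continuous_on UNIV f"
  using smooth_with_GDERIV unfolding gderiv_def
  by (metis continuous_at_imp_continuous_on has_derivative_continuous)

lemma smooth_with_continuous_grad:
  fixes f :: "'a::euclidean_space \<Rightarrow> real"
  assumes "smooth_with L f"
  shows "continuous_on UNIV (grad f)"
proof (rule lipschitz_on_continuous_on)
  \<comment> \<open>\<open>lipschitz_on\<close> demands a nonnegative constant, and
    \<open>smooth_with\<close> says nothing about the sign of \<open>L\<close>.\<close>
  show "(max L 0)-lipschitz_on UNIV (grad f)"
  proof (rule lipschitz_onI)
    fix x y :: 'a
    have "L * norm (x - y) \<le> max L 0 * norm (x - y)" by (intro mult_right_mono) auto
    then show "dist (grad f x) (grad f y) \<le> max L 0 * dist x y"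
      using smooth_with_lipschitz[OF assms, of x y] by (simp add: dist_norm)
  qed simp
qed

lemma smooth_with_descent:
  assumes "smooth_with L f"
  shows "f y \<le> f x + (y - x) \<bullet> grad f x + L / 2 * (norm (y - x))\<^sup>2"
proof -
  define v where "v = y - x"
  \<comment> \<open>\<open>h\<close> is \<open>f\<close> along the segment minus the linear and
    quadratic parts of the claimed bound. Its derivative is \<open>v \<bullet> (grad f (x + t
    *\<^sub>R v) - grad f x) - L * t * (norm v)\<^sup>2\<close>, nonpositive by Cauchy-Schwarz and
    the Lipschitz bound.\<close>
  define h where "h t = f (x + t *\<^sub>R v) - t * (v \<bullet> grad f x) - L / 2 * t\<^sup>2 * (norm v)\<^sup>2" for t
  have "h 1 \<le> h 0"
  proof (rule DERIV_nonpos_imp_nonincreasing[of 0 1 h])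
    fix t :: real assume t: "0 \<le> t" "t \<le> 1"
    have "((\<lambda>t. f (x + t *\<^sub>R v)) has_derivative (\<lambda>s. (s *\<^sub>R v) \<bullet> grad f (x + t *\<^sub>R v))) (at t)"
      by (rule has_derivative_compose[where g = f, OF _ smooth_with_GDERIV[OF assms, unfolded gderiv_def]])
        (auto intro!: derivative_eq_intros)
    then have "((\<lambda>t. f (x + t *\<^sub>R v)) has_real_derivative v \<bullet> grad f (x + t *\<^sub>R v)) (at t)"
      by (auto simp: has_field_derivative_def elim!: has_derivative_eq_rhs)
    then have "(h has_real_derivative (v \<bullet> grad f (x + t *\<^sub>R v) - v \<bullet> grad f x - L * t * (norm v)\<^sup>2)) (at t)"
      unfolding h_def by (auto intro!: derivative_eq_intros)
    moreover have "v \<bullet> (grad f (x + t *\<^sub>R v) - grad f x) \<le> norm v * (L * norm (t *\<^sub>R v))"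
      using smooth_with_lipschitz[OF assms, of "x + t *\<^sub>R v" x]
      by (intro order_trans[OF norm_cauchy_schwarz] mult_left_mono) auto
    ultimately show "\<exists>D. (h has_real_derivative D) (at t) \<and> D \<le> 0"
      using t by (auto intro!: exI[of _ "v \<bullet> grad f (x + t *\<^sub>R v) - v \<bullet> grad f x - L * t * (norm v)\<^sup>2"]
          simp: inner_diff_right power2_eq_square ac_simps)
  qed simp
  then show ?thesis by (simp add: h_def v_def)
qed

lemma average_GDERIV:
  assumes "\<And>i. i \<in> {1..n} \<Longrightarrow> GDERIV (f i) x :> D i"
  shows "GDERIV (average n f) x :> (1 / real n) *\<^sub>R (\<Sum>i=1..n. D i)"
proof -
  have "((\<lambda>x. 1 / real n * (\<Sum>i=1..n. f i x)) has_derivative (\<lambda>h. 1 / real n * (\<Sum>i=1..n. h \<bullet> D i))) (at x)"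
    using assms unfolding gderiv_def by (intro has_derivative_mult_right has_derivative_sum) auto
  then show ?thesis
    by (simp add: gderiv_def average_def[abs_def] inner_sum_right)
qed

lemma norm_average_sq_le:
  fixes v :: "nat \<Rightarrow> 'b::real_inner"
  shows "(norm ((1 / real n) *\<^sub>R (\<Sum>i=1..n. v i)))\<^sup>2 \<le> 1 / real n * (\<Sum>i=1..n. (norm (v i))\<^sup>2)"
proof (cases "n = 0")
  case False
  have "(norm (\<Sum>i=1..n. v i))\<^sup>2 \<le> (\<Sum>i=1..n. norm (v i))\<^sup>2"
    by (intro power_mono norm_sum) auto
  also have "\<dots> \<le> real n * (\<Sum>i=1..n. (norm (v i))\<^sup>2)"
    using sum_squared_le_sum_of_squares[of "\<lambda>i. norm (v i)" "{1..n}"] by (simp add: mult.commute)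
  finally show ?thesis
    using False by (simp add: power_mult_distrib power_divide field_simps power2_eq_square)
qed simp

text \<open>The gradient of the average is the average of the gradients, and convexity of the
  squared norm turns the individual Lipschitz constants into their quadratic mean.\<close>

lemma average_smooth_with:
  assumes "\<forall>i\<in>{1..n}. smooth_with (Ls i) (f i)"
  shows "smooth_with (sqrt (1 / real n * (\<Sum>i=1..n. (Ls i)\<^sup>2))) (average n f)"
    and "grad (average n f) x = (1 / real n) *\<^sub>R (\<Sum>i=1..n. grad (f i) x)"
proof -
  have G: "GDERIV (average n f) x :> (1 / real n) *\<^sub>R (\<Sum>i=1..n. grad (f i) x)" for x
    using assms smooth_with_GDERIV by (intro average_GDERIV) blast
  then show grad: "grad (average n f) x = (1 / real n) *\<^sub>R (\<Sum>i=1..n. grad (f i) x)" for x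
    by (rule grad_eqI)
  have "norm (grad (average n f) x - grad (average n f) y) \<le> sqrt (1 / real n * (\<Sum>i=1..n. (Ls i)\<^sup>2)) * norm (x - y)" for x y
  proof (rule power2_le_imp_le)
    have "(norm (grad (average n f) x - grad (average n f) y))\<^sup>2 \<le> 1 / real n * (\<Sum>i=1..n. (norm (grad (f i) x - grad (f i) y))\<^sup>2)"
      using norm_average_sq_le[of n "\<lambda>i. grad (f i) x - grad (f i) y"]
      by (simp add: grad sum_subtractf scaleR_right_diff_distrib)
    also have "\<dots> \<le> 1 / real n * (\<Sum>i=1..n. (Ls i * norm (x - y))\<^sup>2)"
      using assms by (intro mult_left_mono sum_mono power_mono smooth_with_lipschitz) auto
    also have "\<dots> = (sqrt (1 / real n * (\<Sum>i=1..n. (Ls i)\<^sup>2)) * norm (x - y))\<^sup>2"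
      by (simp add: power_mult_distrib sum_distrib_right[symmetric] sum_nonneg)
    finally show "(norm (grad (average n f) x - grad (average n f) y))\<^sup>2 \<le> \<dots>" .
  qed (auto intro!: mult_nonneg_nonneg divide_nonneg_nonneg sum_nonneg)
  then show "smooth_with (sqrt (1 / real n * (\<Sum>i=1..n. (Ls i)\<^sup>2))) (average n f)"
    using G unfolding smooth_with_def by blast
qed

text \<open>This settles the degenerate smoothness constant, where the stepsize bound divides by 0.
  A unit step against the gradient at the minimizer cannot decrease \<open>F\<close>, which forces
  that gradient to vanish; \<open>L \<le> 0\<close> makes the gradient constant, hence zero
  everywhere, and then the Polyak-Lojasiewicz inequality leaves no gap.\<close>

lemma smooth_with_0_PL_const:
  assumes smooth: "smooth_with L F" and L: "L \<le> 0"
    and min: "\<And>x. F m \<le> F x" and PL: "polyak_lojasiewicz \<mu> F m" "0 < \<mu>"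
  shows "F x = F m"
proof -
  have "F (m - grad F m) \<le> F m - (norm (grad F m))\<^sup>2 + L / 2 * (norm (grad F m))\<^sup>2"
    using smooth_with_descent[OF smooth, of "m - grad F m" m] by (simp add: power2_norm_eq_inner)
  moreover have "L / 2 * (norm (grad F m))\<^sup>2 \<le> 0"
    using L by (simp add: mult_nonpos_nonneg)
  ultimately have "(norm (grad F m))\<^sup>2 \<le> 0"
    using min[of "m - grad F m"] by linarith
  then have "grad F m = 0" by simp
  moreover have "norm (grad F x - grad F m) \<le> L * norm (x - m)"
    by (rule smooth_with_lipschitz[OF smooth])
  then have "norm (grad F x - grad F m) \<le> 0"
    using mult_nonpos_nonneg[OF L norm_ge_zero[of "x - m"]] by linarith
  ultimately have "grad F x = 0" by simp
  then have "2 * \<mu> * (F x - F m) \<le> 0"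
    using PL(1) unfolding polyak_lojasiewicz_def by (metis norm_zero power_zero_numeral)
  then show ?thesis using PL(2) min[of x] by (simp add: mult_le_0_iff)
qed

section \<open>Quantization operators\<close>

lemma nnz_nonneg [simp]: "0 \<le> nnz y"
  by (simp add: nnz_def)

lemma nnz_le_CARD [simp]: "nnz (y :: real ^ 'd) \<le> real CARD('d)"
  by (auto simp: nnz_def intro: card_mono)

lemma nnz_eq_0_iff: "nnz y = 0 \<longleftrightarrow> y = 0"
  by (auto simp: nnz_def vec_eq_iff)

lemma borel_measurable_nnz [measurable]: "(nnz :: real ^ 'd \<Rightarrow> real) \<in> borel_measurable borel"
proof -
  have eq: "(nnz :: real ^ 'd \<Rightarrow> real) = (\<lambda>y :: real ^ 'd. \<Sum>i\<in>UNIV. if y $ i \<noteq> 0 then 1 else 0)"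
    by (auto simp: nnz_def sum.If_cases)
  have [measurable]: "(\<lambda>y :: real ^ 'd. y $ i) \<in> borel_measurable borel" for i
    by (intro borel_measurable_continuous_onI continuous_intros)
  show ?thesis unfolding eq by measurable
qed

context
  fixes \<omega> :: real and Q :: "real ^ 'd \<Rightarrow> (real ^ 'd) measure"
  assumes Q: "quantization \<omega> Q"
begin

lemma quantization_kernel [measurable]: "Q \<in> borel \<rightarrow>\<^sub>M prob_algebra borel"
  using Q unfolding quantization_def by blast

lemma quantization_prob: "prob_space (Q z)" "sets (Q z) = sets borel"
  using measurable_space[OF quantization_kernel, of z] by (auto simp: space_prob_algebra)

lemma integrable_nnz: "integrable (Q z) nnz"
proof -
  note [measurable_cong] = quantization_prob(2)
  show ?thesis
    by (intro finite_measure.integrable_const_bound[OF prob_space.finite_measure[OF quantization_prob(1)], where B = "real CARD('d)"]) auto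
qed

lemma integral_nnz_le: "(\<integral>y. nnz y \<partial>Q z) \<le> real CARD('d)"
  using prob_space.integral_le_const[OF quantization_prob(1) integrable_nnz] by auto

text \<open>A real supremum is an upper bound only for a family bounded above; here the dimension is
  such a bound.\<close>

lemma integral_nnz_le_expected_density: "(\<integral>y. nnz y \<partial>Q z) \<le> expected_density Q"
  unfolding expected_density_def
  by (intro cSUP_upper bdd_aboveI2[where M = "real CARD('d)"] integral_nnz_le) auto

lemma nn_integral_nnz_le: "(\<integral>\<^sup>+y. ennreal (nnz y) \<partial>Q z) \<le> ennreal (expected_density Q)"
  using integral_nnz_le_expected_density[of z] integrable_nnz[of z]
  by (subst nn_integral_eq_integral) (auto intro: ennreal_leI)

lemma expected_density_le: "expected_density Q \<le> real CARD('d)"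
  unfolding expected_density_def by (intro cSUP_least integral_nnz_le) auto

text \<open>With density 0 the quantizer would output 0 almost surely on every input, which
  contradicts unbiasedness at a nonzero vector such as a basis vector. This makes the coin
  probability \<open>p\<close> of the theorem positive.\<close>

lemma expected_density_pos: "0 < expected_density Q"
proof -
  define z :: "real ^ 'd" where "z = axis undefined 1"
  note [measurable_cong] = quantization_prob(2)
  have "(\<integral>y. nnz y \<partial>Q z) \<noteq> 0"
  proof
    assume "(\<integral>y. nnz y \<partial>Q z) = 0"
    then have "AE y in Q z. y = 0"
      using integrable_nnz[of z] by (subst (asm) integral_nonneg_eq_0_iff_AE) (auto simp: nnz_eq_0_iff)
    then have "(\<integral>y. y \<partial>Q z) = 0"
      by (simp add: integral_eq_zero_AE)
    moreover have "(\<integral>y. y \<partial>Q z) = z"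
      using Q unfolding quantization_def by blast
    ultimately show False by (simp add: z_def axis_eq_0_iff)
  qed
  moreover have "0 \<le> (\<integral>y. nnz y \<partial>Q z)" by simp
  ultimately show ?thesis using integral_nnz_le_expected_density[of z] by linarith
qed

end

section \<open>The method\<close>

abbreviation (input) clients :: "nat \<Rightarrow> nat \<Rightarrow> nat list pmf" where
  "clients n r \<equiv> replicate_pmf r (pmf_of_set {1..n})"

context
  fixes n r :: nat and p \<gamma> \<omega> L :: real and Q :: "real ^ 'd \<Rightarrow> (real ^ 'd) measure"
    and f :: "nat \<Rightarrow> real ^ 'd \<Rightarrow> real" and Ls :: "nat \<Rightarrow> real" and F :: "real ^ 'd \<Rightarrow> real"
  assumes r: "1 \<le> r" "r \<le> n" and p: "0 < p" "p \<le> 1"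
    and Q: "quantization \<omega> Q"
    and smooth: "\<forall>i\<in>{1..n}. smooth_with (Ls i) (f i)"
    and F: "F = average n f"
    and L: "L = sqrt (1 / real n * (\<Sum>i=1..n. (Ls i)\<^sup>2))"
begin

section \<open>The transition kernel of one step: measurability and expectations\<close>

definition msgs :: "nat list \<Rightarrow> real ^ 'd \<Rightarrow> real ^ 'd \<Rightarrow> (nat \<Rightarrow> real ^ 'd) measure" where
  "msgs J x x' = PiM {..<r} (\<lambda>j. Q (grad (f (J ! j)) x' - grad (f (J ! j)) x))"

lemma set_clients: "J \<in> set_pmf (clients n r) \<Longrightarrow> j < r \<Longrightarrow> J ! j \<in> {1..n}"
  using r by (auto simp: set_replicate_pmf set_pmf_of_set)

lemma finite_clients: "finite (set_pmf (clients n r))"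
  using r by (auto simp: set_replicate_pmf set_pmf_of_set intro: finite_subset[OF _ finite_lists_length_eq])

lemma msgs_in_prob_algebra: "msgs J x x' \<in> space (prob_algebra (PiM {..<r} (\<lambda>_. borel)))"
  unfolding msgs_def space_prob_algebra
  using quantization_prob[OF Q] by (auto intro!: prob_space_PiM sets_PiM_cong)

lemma prob_space_msgs: "prob_space (msgs J x x')"
  and sets_msgs [measurable_cong]: "sets (msgs J x x') = sets (PiM {..<r} (\<lambda>_. borel))"
  using msgs_in_prob_algebra by (auto simp: space_prob_algebra)

lemma measurable_grad: "i \<in> {1..n} \<Longrightarrow> grad (f i) \<in> borel_measurable borel"
  using smooth by (intro borel_measurable_continuous_onI smooth_with_continuous_grad) blast

lemma measurable_F [measurable]: "F \<in> borel_measurable borel" "grad F \<in> borel_measurable borel"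
  using average_smooth_with(1)[OF smooth, folded F]
  by (intro borel_measurable_continuous_onI smooth_with_continuous_grad smooth_with_continuous; simp)+

lemma measurable_triple [measurable]:
  "(fst :: (real ^ 'd) \<times> (real ^ 'd) \<times> real \<Rightarrow> _) \<in> borel \<rightarrow>\<^sub>M borel"
  "(\<lambda>z :: (real ^ 'd) \<times> (real ^ 'd) \<times> real. fst (snd z)) \<in> borel \<rightarrow>\<^sub>M borel"
  "(\<lambda>z :: (real ^ 'd) \<times> (real ^ 'd) \<times> real. snd (snd z)) \<in> borel \<rightarrow>\<^sub>M borel"
  by (intro borel_measurable_continuous_onI continuous_intros)+

lemma client_round_kernel:
  "(\<lambda>q. return borel (x', g + (1 / real r) *\<^sub>R (\<Sum>j<r. q j), s + (\<Sum>j<r. nnz (q j))))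
    \<in> PiM {..<r} (\<lambda>_. borel) \<rightarrow>\<^sub>M prob_algebra (borel :: ((real ^ 'd) \<times> (real ^ 'd) \<times> real) measure)"
  by (rule measurable_compose[OF _ measurable_return_prob_space], intro borel_measurable_Pair) measurable

lemma pp_marina_step_kernel [measurable]:
  "pp_marina_step n r p \<gamma> Q f \<in> borel \<rightarrow>\<^sub>M prob_algebra borel"
proof -
  define A :: "(real ^ 'd) \<times> (real ^ 'd) \<times> real \<Rightarrow> ((real ^ 'd) \<times> (real ^ 'd) \<times> real) measure"
    where "A z = (let x' = fst z - \<gamma> *\<^sub>R fst (snd z) in
      return borel (x', grad F x', snd (snd z) + (\<Sum>i=1..n. nnz (grad (f i) x'))))" for z
  define B :: "nat list \<Rightarrow> (real ^ 'd) \<times> (real ^ 'd) \<times> real \<Rightarrow> ((real ^ 'd) \<times> (real ^ 'd) \<times> real) measure"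
    where "B J z = (let x' = fst z - \<gamma> *\<^sub>R fst (snd z) in msgs J (fst z) x' \<bind> (\<lambda>q.
      return borel (x', fst (snd z) + (1 / real r) *\<^sub>R (\<Sum>j<r. q j), snd (snd z) + (\<Sum>j<r. nnz (q j)))))" for J z
  \<comment> \<open>\<open>B J\<close> may fail to be measurable for lists \<open>J\<close> with entries outside \<open>{1..n}\<close>, since nothing is
    assumed about \<open>f i\<close> there; these lists have probability 0.\<close>
  have step: "pp_marina_step n r p \<gamma> Q f =
    (\<lambda>z. measure_pmf (bernoulli_pmf p) \<bind> (\<lambda>c. if c then A z else measure_pmf (clients n r) \<bind> (\<lambda>J. B J z)))"
    by (auto simp: fun_eq_iff pp_marina_step_def A_def B_def msgs_def Let_def F cong: if_cong)
  have A: "A \<in> borel \<rightarrow>\<^sub>M prob_algebra borel"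
  proof -
    note measurable_grad[measurable]
    show ?thesis
      unfolding A_def Let_def
      by (rule measurable_compose[OF _ measurable_return_prob_space], intro borel_measurable_Pair) measurable
  qed
  \<comment> \<open>Unlike measurability in \<open>z\<close>, this holds for every list
    \<open>J\<close>: at a fixed state the messages have a product of probability measures as their
    law, whatever the gradients are.\<close>
  have B_prob: "B J z \<in> space (prob_algebra borel)" for J z
    unfolding B_def Let_def space_prob_algebra
    using prob_space_bind'[OF msgs_in_prob_algebra client_round_kernel]
      sets_bind'[OF msgs_in_prob_algebra client_round_kernel] by auto
  have B: "B J \<in> borel \<rightarrow>\<^sub>M prob_algebra borel" if J: "J \<in> set_pmf (clients n r)" for J
    unfolding B_def Let_def
  proof (rule measurable_bind_prob_space2)
    show "(\<lambda>z :: (real ^ 'd) \<times> (real ^ 'd) \<times> real. msgs J (fst z) (fst z - \<gamma> *\<^sub>R fst (snd z))) \<in> borel \<rightarrow>\<^sub>M prob_algebra (PiM {..<r} (\<lambda>_. borel))"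
      unfolding msgs_def
    proof (rule measurable_PiM_prob_algebra)
      fix j assume "j \<in> {..<r}"
      then have [measurable]: "grad (f (J ! j)) \<in> borel_measurable borel"
        by (intro measurable_grad set_clients[OF J]) simp
      show "(\<lambda>z :: (real ^ 'd) \<times> (real ^ 'd) \<times> real. Q (grad (f (J ! j)) (fst z - \<gamma> *\<^sub>R fst (snd z)) - grad (f (J ! j)) (fst z))) \<in> borel \<rightarrow>\<^sub>M prob_algebra borel"
        by (intro measurable_compose[OF _ quantization_kernel[OF Q]]) measurable
    qed simp
    show "(\<lambda>(z, q). return borel (fst z - \<gamma> *\<^sub>R fst (snd z), fst (snd z) + (1 / real r) *\<^sub>R (\<Sum>j<r. q j),
        snd (snd z) + (\<Sum>j<r. nnz (q j)))) \<in> borel \<Otimes>\<^sub>M PiM {..<r} (\<lambda>_. borel) \<rightarrow>\<^sub>M prob_algebra borel"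
      unfolding split_beta borel_prod[symmetric]
      by (rule measurable_compose[OF _ measurable_return_prob_space]) measurable
  qed
  have C: "(\<lambda>z. measure_pmf (clients n r) \<bind> (\<lambda>J. B J z)) \<in> borel \<rightarrow>\<^sub>M prob_algebra borel"
    using finite_clients B B_prob by (rule measurable_bind_pmf_finite)
  show ?thesis
    unfolding step
  proof (rule measurable_bind_pmf_finite)
    fix c z
    show "(if c then A z else measure_pmf (clients n r) \<bind> (\<lambda>J. B J z)) \<in> space (prob_algebra borel)"
      using measurable_space[OF A] measurable_space[OF C] by auto
    show "(\<lambda>z. if c then A z else measure_pmf (clients n r) \<bind> (\<lambda>J. B J z)) \<in> borel \<rightarrow>\<^sub>M prob_algebra borel"
      using A C by (cases c) auto
  qed simp
qed

text \<open>Conditioning on the coin, then on the clients, then on the messages. The test function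
  \<open>h\<close> is arbitrary because the formula serves both the Lyapunov function and the
  communication cost.\<close>

lemma nn_integral_pp_marina_step:
  assumes [measurable]: "h \<in> borel_measurable borel" and x': "x' = x - \<gamma> *\<^sub>R g"
  shows "(\<integral>\<^sup>+z. h z \<partial>pp_marina_step n r p \<gamma> Q f (x, g, s)) =
    h (x', grad F x', s + (\<Sum>i=1..n. nnz (grad (f i) x'))) * ennreal p +
    (\<integral>\<^sup>+J. \<integral>\<^sup>+q. h (x', g + (1 / real r) *\<^sub>R (\<Sum>j<r. q j), s + (\<Sum>j<r. nnz (q j)))
       \<partial>msgs J x x' \<partial>measure_pmf (clients n r)) * ennreal (1 - p)"
proof -
  define A where "A = return borel (x', grad F x', s + (\<Sum>i=1..n. nnz (grad (f i) x')))"
  define R where "R q = return borel (x', g + (1 / real r) *\<^sub>R (\<Sum>j<r. q j), s + (\<Sum>j<r. nnz (q j)))" for q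
  have R: "R \<in> PiM {..<r} (\<lambda>_. borel) \<rightarrow>\<^sub>M prob_algebra borel"
    unfolding R_def by (rule client_round_kernel)
  have B: "msgs J x x' \<bind> R \<in> space (prob_algebra borel)" for J
    using prob_space_bind'[OF msgs_in_prob_algebra R] sets_bind'[OF msgs_in_prob_algebra R]
    by (auto simp: space_prob_algebra)
  have clients: "measure_pmf (clients n r) \<in> space (prob_algebra (count_space UNIV))"
    by (simp add: space_prob_algebra measure_pmf.prob_space_axioms)
  have BJ: "(\<lambda>J. msgs J x x' \<bind> R) \<in> count_space UNIV \<rightarrow>\<^sub>M prob_algebra borel"
    using B by simp
  have C: "measure_pmf (clients n r) \<bind> (\<lambda>J. msgs J x x' \<bind> R) \<in> space (prob_algebra borel)"
    using prob_space_bind'[OF clients BJ] sets_bind'[OF clients BJ] by (auto simp: space_prob_algebra)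
  have A: "A \<in> space (prob_algebra borel)"
    by (auto simp: A_def space_prob_algebra intro: prob_space_return)
  have "pp_marina_step n r p \<gamma> Q f (x, g, s) =
    measure_pmf (bernoulli_pmf p) \<bind> (\<lambda>c. if c then A else measure_pmf (clients n r) \<bind> (\<lambda>J. msgs J x x' \<bind> R))"
    by (simp add: pp_marina_step_def A_def R_def[abs_def] msgs_def Let_def x' F cong: if_cong)
  moreover have "(\<integral>\<^sup>+z. h z \<partial>(measure_pmf (bernoulli_pmf p) \<bind> (\<lambda>c. if c then A else measure_pmf (clients n r) \<bind> (\<lambda>J. msgs J x x' \<bind> R)))) =
     (\<integral>\<^sup>+c. \<integral>\<^sup>+z. h z \<partial>(if c then A else measure_pmf (clients n r) \<bind> (\<lambda>J. msgs J x x' \<bind> R)) \<partial>measure_pmf (bernoulli_pmf p))"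
    using A C by (intro nn_integral_bind[where B = borel] measurable_prob_algebraD) auto
  moreover have "\<dots> = (\<integral>\<^sup>+z. h z \<partial>A) * ennreal p + (\<integral>\<^sup>+z. h z \<partial>(measure_pmf (clients n r) \<bind> (\<lambda>J. msgs J x x' \<bind> R))) * ennreal (1 - p)"
    using p by simp
  moreover have "(\<integral>\<^sup>+z. h z \<partial>A) = h (x', grad F x', s + (\<Sum>i=1..n. nnz (grad (f i) x')))"
    unfolding A_def by (rule nn_integral_return) auto
  moreover have "(\<integral>\<^sup>+z. h z \<partial>(measure_pmf (clients n r) \<bind> (\<lambda>J. msgs J x x' \<bind> R))) =
      (\<integral>\<^sup>+J. \<integral>\<^sup>+z. h z \<partial>(msgs J x x' \<bind> R) \<partial>measure_pmf (clients n r))"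
    using BJ by (intro nn_integral_bind[where B = borel] measurable_prob_algebraD) auto
  moreover have "(\<integral>\<^sup>+z. h z \<partial>(msgs J x x' \<bind> R)) = (\<integral>\<^sup>+q. \<integral>\<^sup>+z. h z \<partial>R q \<partial>msgs J x x')" for J
    using R by (intro nn_integral_bind[where B = borel] measurable_prob_algebraD)
      (auto simp: measurable_cong_sets[OF sets_msgs refl])
  moreover have "(\<integral>\<^sup>+z. h z \<partial>R q) = h (x', g + (1 / real r) *\<^sub>R (\<Sum>j<r. q j), s + (\<Sum>j<r. nnz (q j)))" for q
    unfolding R_def by (rule nn_integral_return) auto
  ultimately show ?thesis by simp
qed

section \<open>Conditional error of the gradient estimator, and expected cost of a step\<close>

lemma \<omega>_pos: "0 < \<omega>"
  using Q unfolding quantization_def by blast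

text \<open>Given \<open>J\<close>, the noises \<open>q j - \<Delta> (J ! j)\<close> are independent
  and centred, so only their variances remain, each scaled by \<open>(1 / real r)\<^sup>2\<close>.
  The bound stays a sum over the draws so that \<open>nn_integral_replicate_pmf_sum\<close> can
  average it over \<open>J\<close>.\<close>

lemma nn_integral_msgs_norm_sq:
  fixes x x'
  defines "\<Delta> \<equiv> \<lambda>i. grad (f i) x' - grad (f i) x"
  shows "(\<integral>\<^sup>+q. ennreal ((norm (b + (\<Sum>j<r. (1 / real r) *\<^sub>R (q j - \<Delta> (J ! j)))))\<^sup>2) \<partial>msgs J x x')
    \<le> ennreal ((norm b)\<^sup>2) + (\<Sum>j<r. ennreal (\<omega> / (real r)\<^sup>2 * (norm (\<Delta> (J ! j)))\<^sup>2))"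
proof -
  have Q': "\<And>z. integrable (Q z) (\<lambda>y. y)" "\<And>z. (\<integral>y. y \<partial>Q z) = z"
    "\<And>z. integrable (Q z) (\<lambda>y. (norm (y - z))\<^sup>2)" "\<And>z. (\<integral>y. (norm (y - z))\<^sup>2 \<partial>Q z) \<le> \<omega> * (norm z)\<^sup>2"
    using Q unfolding quantization_def by blast+
  have msgs: "msgs J x x' = PiM {..<r} (\<lambda>j. Q (\<Delta> (J ! j)))"
    by (simp add: msgs_def \<Delta>_def)
  have "(\<integral>\<^sup>+q. ennreal ((norm (b + (\<Sum>j<r. (1 / real r) *\<^sub>R (q j - \<Delta> (J ! j)))))\<^sup>2) \<partial>msgs J x x') =
    ennreal ((norm b)\<^sup>2 + (1 / real r)\<^sup>2 * (\<Sum>j<r. \<integral>y. (norm (y - \<Delta> (J ! j)))\<^sup>2 \<partial>Q (\<Delta> (J ! j))))"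
    unfolding msgs using quantization_prob[OF Q] Q'
    by (intro nn_integral_PiM_norm_sum_sq) simp_all
  also have "\<dots> \<le> ennreal ((norm b)\<^sup>2 + (1 / real r)\<^sup>2 * (\<Sum>j<r. \<omega> * (norm (\<Delta> (J ! j)))\<^sup>2))"
    by (intro ennreal_leI add_left_mono mult_left_mono sum_mono Q') auto
  also have "\<dots> = ennreal ((norm b)\<^sup>2) + (\<Sum>j<r. ennreal (\<omega> / (real r)\<^sup>2 * (norm (\<Delta> (J ! j)))\<^sup>2))"
    using \<omega>_pos by (subst sum_ennreal)
      (auto simp: sum_distrib_left power_divide intro!: ennreal_plus sum_nonneg mult_nonneg_nonneg)
  finally show ?thesis .
qed

lemma nn_integral_estimator_error:
  "(\<integral>\<^sup>+J. \<integral>\<^sup>+q. ennreal ((norm (g + (1 / real r) *\<^sub>R (\<Sum>j<r. q j) - grad F x'))\<^sup>2) \<partial>msgs J x x' \<partial>measure_pmf (clients n r))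
    \<le> ennreal ((norm (g - grad F x))\<^sup>2 + (1 + \<omega>) * L\<^sup>2 / real r * (norm (x' - x))\<^sup>2)"
proof -
  let ?P = "pmf_of_set {1..n}"
  define \<Delta> where "\<Delta> i = grad (f i) x' - grad (f i) x" for i
  define m where "m = grad F x' - grad F x"
  define a where "a = g - grad F x"
  define S where "S = (\<integral>i. (norm (\<Delta> i))\<^sup>2 \<partial>measure_pmf ?P)"
  have n: "n > 0" "{1..n} \<noteq> {}" "finite {1..n}" using r by auto
  have fin: "finite (set_pmf ?P)" using n by (simp add: set_pmf_of_set)
  have mean: "(\<integral>i. \<Delta> i \<partial>measure_pmf ?P) = m"
    using n by (subst integral_measure_pmf[of "{1..n}"])
      (auto simp: set_pmf_of_set pmf_of_set \<Delta>_def m_def average_smooth_with(2)[OF smooth, folded F]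
        scaleR_right_diff_distrib sum_subtractf scaleR_sum_right)
  \<comment> \<open>\<open>bias_variance\<close> with the mean itself as offset: second moment
    equals squared mean plus variance. Hence the variance of \<open>\<Delta>\<close> is at most
    \<open>S\<close>.\<close>
  have S: "S = (norm m)\<^sup>2 + (\<integral>i. (norm (\<Delta> i - m))\<^sup>2 \<partial>measure_pmf ?P)"
    using bias_variance(2)[OF measure_pmf.prob_space_axioms, of ?P \<Delta> m m] mean integrable_measure_pmf_finite[OF fin, of \<Delta>]
      integrable_measure_pmf_finite[OF fin, of "\<lambda>i. (norm (\<Delta> i - m))\<^sup>2"]
    by (simp add: S_def)
  \<comment> \<open>The error is the old error \<open>a\<close>, plus the deviation caused by
    sampling clients, plus the quantization noise. The inner integral treats the first two as its
    offset, the outer one then treats \<open>a\<close> as its offset.\<close>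
  have split: "g + (1 / real r) *\<^sub>R (\<Sum>j<r. q j) - grad F x' =
      (a + (\<Sum>j<r. (1 / real r) *\<^sub>R (\<Delta> (J ! j) - m))) + (\<Sum>j<r. (1 / real r) *\<^sub>R (q j - \<Delta> (J ! j)))" for q J
  proof -
    have "(1 / real r) *\<^sub>R (\<Sum>j<r. m) = m" using r by (simp add: sum_constant_scaleR del: sum_constant)
    then have "(\<Sum>j<r. (1 / real r) *\<^sub>R (\<Delta> (J ! j) - m)) = (1 / real r) *\<^sub>R (\<Sum>j<r. \<Delta> (J ! j)) - m"
      by (simp only: scaleR_sum_right[symmetric] sum_subtractf scaleR_right_diff_distrib)
    moreover have "(\<Sum>j<r. (1 / real r) *\<^sub>R (q j - \<Delta> (J ! j))) = (1 / real r) *\<^sub>R (\<Sum>j<r. q j) - (1 / real r) *\<^sub>R (\<Sum>j<r. \<Delta> (J ! j))"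
      by (simp only: scaleR_sum_right[symmetric] sum_subtractf scaleR_right_diff_distrib)
    ultimately show ?thesis by (simp only: a_def m_def) simp
  qed
  have "(\<integral>\<^sup>+J. \<integral>\<^sup>+q. ennreal ((norm (g + (1 / real r) *\<^sub>R (\<Sum>j<r. q j) - grad F x'))\<^sup>2) \<partial>msgs J x x' \<partial>measure_pmf (clients n r))
    \<le> (\<integral>\<^sup>+J. ennreal ((norm (a + (\<Sum>j<r. (1 / real r) *\<^sub>R (\<Delta> (J ! j) - m))))\<^sup>2)
        + (\<Sum>j<r. ennreal (\<omega> / (real r)\<^sup>2 * (norm (\<Delta> (J ! j)))\<^sup>2)) \<partial>measure_pmf (clients n r))"
  proof (rule nn_integral_mono)
    fix J
    show "(\<integral>\<^sup>+q. ennreal ((norm (g + (1 / real r) *\<^sub>R (\<Sum>j<r. q j) - grad F x'))\<^sup>2) \<partial>msgs J x x') \<le>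
      ennreal ((norm (a + (\<Sum>j<r. (1 / real r) *\<^sub>R (\<Delta> (J ! j) - m))))\<^sup>2)
        + (\<Sum>j<r. ennreal (\<omega> / (real r)\<^sup>2 * (norm (\<Delta> (J ! j)))\<^sup>2))"
      unfolding split[of _ J] unfolding \<Delta>_def by (rule nn_integral_msgs_norm_sq)
  qed
  also have "\<dots> = ennreal ((norm a)\<^sup>2 + real r * (1 / real r)\<^sup>2 * (\<integral>i. (norm (\<Delta> i - m))\<^sup>2 \<partial>measure_pmf ?P))
      + of_nat r * (\<integral>\<^sup>+i. ennreal (\<omega> / (real r)\<^sup>2 * (norm (\<Delta> i))\<^sup>2) \<partial>measure_pmf ?P)"
    unfolding nn_integral_replicate_pmf_norm_sum_sq[OF fin mean, symmetric]
      nn_integral_replicate_pmf_sum[symmetric]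
    by (rule nn_integral_add) auto
  also have "(\<integral>\<^sup>+i. ennreal (\<omega> / (real r)\<^sup>2 * (norm (\<Delta> i))\<^sup>2) \<partial>measure_pmf ?P) = ennreal (\<omega> / (real r)\<^sup>2 * S)"
  proof -
    have "integrable (measure_pmf ?P) (\<lambda>i. \<omega> / (real r)\<^sup>2 * (norm (\<Delta> i))\<^sup>2)"
      by (rule integrable_measure_pmf_finite[OF fin])
    then have "(\<integral>\<^sup>+i. ennreal (\<omega> / (real r)\<^sup>2 * (norm (\<Delta> i))\<^sup>2) \<partial>measure_pmf ?P) =
        ennreal (\<integral>i. \<omega> / (real r)\<^sup>2 * (norm (\<Delta> i))\<^sup>2 \<partial>measure_pmf ?P)"
      using \<omega>_pos by (intro nn_integral_eq_integral) auto
    then show ?thesis by (simp only: S_def integral_mult_right_zero)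
  qed
  also have "ennreal ((norm a)\<^sup>2 + real r * (1 / real r)\<^sup>2 * (\<integral>i. (norm (\<Delta> i - m))\<^sup>2 \<partial>measure_pmf ?P))
      + of_nat r * ennreal (\<omega> / (real r)\<^sup>2 * S)
    = ennreal ((norm a)\<^sup>2 + 1 / real r * (\<integral>i. (norm (\<Delta> i - m))\<^sup>2 \<partial>measure_pmf ?P) + \<omega> / real r * S)"
    (is "ennreal ?A + _ * ennreal ?B = ennreal ?C")
  proof -
    have nonneg: "0 \<le> ?A" "0 \<le> ?B"
      using \<omega>_pos unfolding S_def
      by (intro add_nonneg_nonneg mult_nonneg_nonneg divide_nonneg_nonneg integral_nonneg, simp_all)+
    have "ennreal ?A + of_nat r * ennreal ?B = ennreal ?A + ennreal (real r * ?B)"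
      by (simp only: ennreal_of_nat_eq_real_of_nat ennreal_mult[OF _ nonneg(2)] of_nat_0_le_iff)
    also have "\<dots> = ennreal (?A + real r * ?B)"
      by (intro ennreal_plus[symmetric] mult_nonneg_nonneg[OF _ nonneg(2)] nonneg(1)) simp
    also have "?A + real r * ?B = ?C"
      using r by (simp add: power2_eq_square)
    finally show ?thesis .
  qed
  \<comment> \<open>The sampling variance is at most \<open>S\<close> and quantization adds
    \<open>\<omega> * S\<close>, whence the factor \<open>1 + \<omega>\<close>; the smoothness of
    each \<open>f i\<close> bounds \<open>S\<close> by
    \<open>L\<^sup>2 * (norm (x' - x))\<^sup>2\<close>.\<close>
  also have "\<dots> \<le> ennreal ((norm a)\<^sup>2 + (1 + \<omega>) * L\<^sup>2 / real r * (norm (x' - x))\<^sup>2)"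
  proof (rule ennreal_leI)
    have "S = (\<Sum>i=1..n. (norm (\<Delta> i))\<^sup>2) / real n"
      using n unfolding S_def by (subst integral_pmf_of_set) auto
    also have "\<dots> \<le> (\<Sum>i=1..n. (Ls i * norm (x' - x))\<^sup>2) / real n"
      using smooth unfolding \<Delta>_def
      by (intro divide_right_mono sum_mono power_mono smooth_with_lipschitz) auto
    also have "\<dots> = L\<^sup>2 * (norm (x' - x))\<^sup>2"
      by (simp add: L power_mult_distrib sum_distrib_right[symmetric] sum_nonneg divide_nonneg_nonneg)
    finally have "(1 + \<omega>) * S \<le> (1 + \<omega>) * (L\<^sup>2 * (norm (x' - x))\<^sup>2)"
      using \<omega>_pos by (intro mult_left_mono) auto
    moreover have "(\<integral>i. (norm (\<Delta> i - m))\<^sup>2 \<partial>measure_pmf ?P) \<le> S"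
      by (simp add: S)
    ultimately have "(\<integral>i. (norm (\<Delta> i - m))\<^sup>2 \<partial>measure_pmf ?P) + \<omega> * S \<le> (1 + \<omega>) * L\<^sup>2 * (norm (x' - x))\<^sup>2"
      unfolding mult.assoc distrib_right[of 1 \<omega> S] by linarith
    from divide_right_mono[OF this, of "real r"]
    show "(norm a)\<^sup>2 + 1 / real r * (\<integral>i. (norm (\<Delta> i - m))\<^sup>2 \<partial>measure_pmf ?P) + \<omega> / real r * S
      \<le> (norm a)\<^sup>2 + (1 + \<omega>) * L\<^sup>2 / real r * (norm (x' - x))\<^sup>2"
      by (simp add: add_divide_distrib)
  qed
  finally show ?thesis by (simp add: a_def)
qed

text \<open>A synchronization sends \<open>n\<close> full vectors; otherwise linearity of
  expectation charges at most the expected density to each of the \<open>r\<close> messages. The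
  absolute value gives a nonnegative integrand for every real \<open>s\<close>.\<close>

lemma nn_integral_step_cost:
  "(\<integral>\<^sup>+z. ennreal \<bar>snd (snd z)\<bar> \<partial>pp_marina_step n r p \<gamma> Q f (x, g, s)) \<le>
    ennreal \<bar>s\<bar> + ennreal (p * (real CARD('d) * real n) + (1 - p) * (real r * expected_density Q))"
proof -
  define x' where "x' = x - \<gamma> *\<^sub>R g"
  have sum_le: "\<bar>s + (\<Sum>i=1..n. nnz (grad (f i) x'))\<bar> \<le> \<bar>s\<bar> + real CARD('d) * real n"
  proof -
    have "(\<Sum>i=1..n. nnz (grad (f i) x')) \<le> (\<Sum>i=1..n. real CARD('d))"
      by (intro sum_mono) simp
    moreover have "0 \<le> (\<Sum>i=1..n. nnz (grad (f i) x'))" by (intro sum_nonneg) simp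
    ultimately show ?thesis by (simp add: mult.commute)
  qed
  have msgs: "(\<integral>\<^sup>+q. ennreal \<bar>s + (\<Sum>j<r. nnz (q j))\<bar> \<partial>msgs J x x') \<le> ennreal (\<bar>s\<bar> + real r * expected_density Q)" for J
  proof -
    have "(\<integral>\<^sup>+q. ennreal \<bar>s + (\<Sum>j<r. nnz (q j))\<bar> \<partial>msgs J x x') \<le>
      (\<integral>\<^sup>+q. ennreal \<bar>s\<bar> + (\<Sum>j<r. ennreal (nnz (q j))) \<partial>msgs J x x')"
    proof (rule nn_integral_mono)
      fix q :: "nat \<Rightarrow> real ^ 'd"
      have "0 \<le> (\<Sum>j<r. nnz (q j))" by (intro sum_nonneg) simp
      then have "ennreal \<bar>s + (\<Sum>j<r. nnz (q j))\<bar> \<le> ennreal (\<bar>s\<bar> + (\<Sum>j<r. nnz (q j)))"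
        by (intro ennreal_leI) linarith
      then show "ennreal \<bar>s + (\<Sum>j<r. nnz (q j))\<bar> \<le> ennreal \<bar>s\<bar> + (\<Sum>j<r. ennreal (nnz (q j)))"
        using \<open>0 \<le> (\<Sum>j<r. nnz (q j))\<close> by (simp add: ennreal_plus sum_ennreal)
    qed
    also have "\<dots> = ennreal \<bar>s\<bar> + (\<Sum>j<r. \<integral>\<^sup>+q. ennreal (nnz (q j)) \<partial>msgs J x x')"
      using prob_space.emeasure_space_1[OF prob_space_msgs]
      by (subst nn_integral_add) (auto simp: nn_integral_sum simp del: sum_ennreal)
    also have "\<dots> \<le> ennreal \<bar>s\<bar> + (\<Sum>j<r. ennreal (expected_density Q))"
    proof (intro add_left_mono sum_mono)
      fix j assume "j \<in> {..<r}"
      note [measurable_cong] = quantization_prob(2)[OF Q]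
      have "(\<integral>\<^sup>+q. ennreal (nnz (q j)) \<partial>msgs J x x') =
        (\<integral>\<^sup>+y. ennreal (nnz y) \<partial>Q (grad (f (J ! j)) x' - grad (f (J ! j)) x))"
        unfolding msgs_def using \<open>j \<in> {..<r}\<close> quantization_prob(1)[OF Q]
        by (intro nn_integral_PiM_component[where h = "\<lambda>y. ennreal (nnz y)"]) auto
      also have "\<dots> \<le> ennreal (expected_density Q)"
        by (rule nn_integral_nnz_le[OF Q])
      finally show "(\<integral>\<^sup>+q. ennreal (nnz (q j)) \<partial>msgs J x x') \<le> ennreal (expected_density Q)" .
    qed
    also have "\<dots> = ennreal (\<bar>s\<bar> + real r * expected_density Q)"
      using expected_density_pos[OF Q] by (simp add: ennreal_plus ennreal_mult ennreal_of_nat_eq_real_of_nat)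
    finally show ?thesis .
  qed
  have "(\<integral>\<^sup>+z. ennreal \<bar>snd (snd z)\<bar> \<partial>pp_marina_step n r p \<gamma> Q f (x, g, s)) =
    ennreal \<bar>s + (\<Sum>i=1..n. nnz (grad (f i) x'))\<bar> * ennreal p +
    (\<integral>\<^sup>+J. \<integral>\<^sup>+q. ennreal \<bar>s + (\<Sum>j<r. nnz (q j))\<bar> \<partial>msgs J x x' \<partial>measure_pmf (clients n r)) * ennreal (1 - p)"
    by (subst nn_integral_pp_marina_step[OF _ x'_def]) auto
  also have "\<dots> \<le> ennreal (\<bar>s\<bar> + real CARD('d) * real n) * ennreal p +
    (\<integral>\<^sup>+J. ennreal (\<bar>s\<bar> + real r * expected_density Q) \<partial>measure_pmf (clients n r)) * ennreal (1 - p)"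
    by (intro add_mono mult_right_mono ennreal_leI nn_integral_mono msgs sum_le) auto
  also have "\<dots> = ennreal (\<bar>s\<bar> + (p * (real CARD('d) * real n) + (1 - p) * (real r * expected_density Q)))"
    (is "?l = ennreal ?R")
  proof -
    have "?l = ennreal ((\<bar>s\<bar> + real CARD('d) * real n) * p) + ennreal ((\<bar>s\<bar> + real r * expected_density Q) * (1 - p))"
      using p expected_density_pos[OF Q] by (simp add: measure_pmf.emeasure_space_1 ennreal_mult)
    also have "\<dots> = ennreal ((\<bar>s\<bar> + real CARD('d) * real n) * p + (\<bar>s\<bar> + real r * expected_density Q) * (1 - p))"
      using p expected_density_pos[OF Q] by (intro ennreal_plus[symmetric]) auto
    also have "\<dots> = ennreal ?R" by (rule arg_cong[where f = ennreal]) (simp add: algebra_simps)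
    finally show ?thesis .
  qed
  finally show ?thesis
    using p expected_density_pos[OF Q] by (simp add: ennreal_plus)
qed

section \<open>Contraction of the Lyapunov function in one step\<close>

definition lyapunov :: "real \<Rightarrow> (real ^ 'd) \<times> (real ^ 'd) \<times> real \<Rightarrow> real" where
  "lyapunov m z = F (fst z) - m + \<gamma> / p * (norm (fst (snd z) - grad F (fst z)))\<^sup>2"

lemma lyapunov_measurable [measurable]: "lyapunov m \<in> borel_measurable borel"
  unfolding lyapunov_def[abs_def] borel_prod[symmetric] by measurable

text \<open>The deterministic core. The factor \<open>1 - p\<close> appears because the error
  survives only when no synchronization takes place. In the descent inequality the term in
  \<open>G\<close> pays for the contraction of the gap, the term in \<open>N\<close> for all
  multiples of \<open>(norm (x' - x))\<^sup>2\<close>, and the shrinking weight of \<open>e\<close>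
  for the remaining \<open>\<gamma> / 2 * e\<close>.\<close>

lemma real_lyapunov_step:
  fixes x g :: "real ^ 'd"
  defines "x' \<equiv> x - \<gamma> *\<^sub>R g"
  assumes \<gamma>: "0 \<le> \<gamma>" "2 * \<mu> * \<gamma> \<le> p"
    and PL: "2 * \<mu> * (F x - m) \<le> (norm (grad F x))\<^sup>2"
    and stepsize: "L * \<gamma> + 2 * ((1 - p) / p * ((1 + \<omega>) / real r)) * (L * \<gamma>)\<^sup>2 \<le> 1"
  shows "F x' - m + \<gamma> / p * (1 - p) * ((norm (g - grad F x))\<^sup>2 + (1 + \<omega>) * L\<^sup>2 / real r * (norm (x' - x))\<^sup>2)
    \<le> (1 - \<gamma> * \<mu>) * lyapunov m (x, g, s)"
proof -
  define e where "e = (norm (g - grad F x))\<^sup>2"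
  define N where "N = (norm g)\<^sup>2"
  define G where "G = (norm (grad F x))\<^sup>2"
  have D: "(norm (x' - x))\<^sup>2 = \<gamma>\<^sup>2 * N"
    by (simp add: x'_def N_def power_mult_distrib)
  \<comment> \<open>Polarization replaces the inner product of the inexact direction with the
    gradient by two squares of favourable sign and the estimator error.\<close>
  have "2 * (g \<bullet> grad F x) = N + G - e"
    by (simp add: e_def N_def G_def power2_norm_eq_inner inner_diff_left inner_diff_right inner_commute)
  then have inner: "(x' - x) \<bullet> grad F x = - (\<gamma> / 2) * (N + G - e)"
    by (simp add: x'_def)
  have descent: "F x' \<le> F x - (\<gamma> / 2 * N + \<gamma> / 2 * G - \<gamma> / 2 * e) + L / 2 * (\<gamma>\<^sup>2 * N)"
    using smooth_with_descent[OF average_smooth_with(1)[OF smooth, folded F L], of x' x] unfolding inner D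
    by (simp add: right_diff_distrib distrib_left)
  have "\<gamma> / 2 * (2 * \<mu> * (F x - m)) \<le> \<gamma> / 2 * G"
    using \<gamma> PL unfolding G_def by (intro mult_left_mono) auto
  moreover have "\<gamma> / 2 * (2 * \<mu> * (F x - m)) = \<gamma> * \<mu> * (F x - m)"
    by simp
  ultimately have gap: "\<gamma> * \<mu> * (F x - m) \<le> \<gamma> / 2 * G"
    by simp
  \<comment> \<open>This is the stepsize condition multiplied by \<open>\<gamma> / 2 * N\<close>:
    its linear term in \<open>L * \<gamma>\<close> covers the smoothness term, its quadratic term
    the growth of the error.\<close>
  have drift: "\<gamma> / p * (1 - p) * ((1 + \<omega>) * L\<^sup>2 / real r * (\<gamma>\<^sup>2 * N)) \<le> \<gamma> / 2 * N - L / 2 * (\<gamma>\<^sup>2 * N)"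
  proof -
    define l where "l = L"
    define A where "A = (1 - p) / p * ((1 + \<omega>) / real r)"
    have "\<gamma> / 2 * N * (l * \<gamma> + 2 * A * (l * \<gamma>)\<^sup>2) \<le> \<gamma> / 2 * N * 1"
      using \<gamma> stepsize unfolding l_def A_def by (intro mult_left_mono) (auto simp: N_def)
    moreover have "\<gamma> / p * (1 - p) * ((1 + \<omega>) * l\<^sup>2 / real r * (\<gamma>\<^sup>2 * N)) = \<gamma> / 2 * N * (2 * A * (l * \<gamma>)\<^sup>2)"
      by (simp add: A_def power2_eq_square)
    moreover have "l / 2 * (\<gamma>\<^sup>2 * N) = \<gamma> / 2 * N * (l * \<gamma>)"
      by (simp add: power2_eq_square)
    ultimately show ?thesis unfolding l_def[symmetric] by (simp only: distrib_left)
  qed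
  \<comment> \<open>The weight \<open>\<gamma> / p\<close> is chosen for this inequality. Averaging
    over the coin removes the share \<open>p\<close> of the weighted error, worth
    \<open>\<gamma> * e\<close>; one half covers \<open>\<gamma> / 2 * e\<close> from the descent,
    the other half covers the contraction since \<open>\<gamma> * \<mu> \<le> p / 2\<close>.\<close>
  have err: "\<gamma> / p * (1 - p) * e + \<gamma> / 2 * e \<le> (1 - \<gamma> * \<mu>) * (\<gamma> / p * e)"
  proof -
    define t where "t = \<gamma> / p * e"
    have "t / 2 * (2 * \<mu> * \<gamma>) \<le> t / 2 * p"
      using \<gamma> p unfolding t_def by (intro mult_left_mono) (auto simp: e_def)
    moreover have "\<gamma> / p * (1 - p) * e + \<gamma> / 2 * e = t * (1 - p) + t * p / 2"
      using p by (simp add: t_def field_simps)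
    ultimately show ?thesis unfolding t_def[symmetric] by (simp add: algebra_simps)
  qed
  have expand: "(1 - \<gamma> * \<mu>) * (F x - m + \<gamma> / p * e) = F x - m - \<gamma> * \<mu> * (F x - m) + (1 - \<gamma> * \<mu>) * (\<gamma> / p * e)"
    by (simp only: distrib_left) (simp add: left_diff_distrib)
  show ?thesis
    unfolding D e_def[symmetric] lyapunov_def fst_conv snd_conv expand distrib_left[of "\<gamma> / p * (1 - p)"]
    using descent gap drift err by linarith
qed

lemma contraction_nonneg:
  assumes "0 \<le> \<gamma>" "2 * \<mu> * \<gamma> \<le> p"
  shows "0 \<le> 1 - \<gamma> * \<mu>"
proof -
  have "2 * (\<gamma> * \<mu>) \<le> p" using assms(2) by (simp add: ac_simps)
  then show ?thesis using p by linarith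
qed

text \<open>The expectation formula and the error bound reduce the claim to
  \<open>real_lyapunov_step\<close>. The lower bound \<open>m\<close> keeps every summand
  nonnegative, so that \<open>ennreal\<close> commutes with the sums and products.\<close>

lemma nn_integral_step_lyapunov:
  assumes \<gamma>: "0 \<le> \<gamma>" "2 * \<mu> * \<gamma> \<le> p"
    and lower: "\<And>x. m \<le> F x"
    and PL: "\<And>x. 2 * \<mu> * (F x - m) \<le> (norm (grad F x))\<^sup>2"
    and stepsize: "L * \<gamma> + 2 * ((1 - p) / p * ((1 + \<omega>) / real r)) * (L * \<gamma>)\<^sup>2 \<le> 1"
  shows "(\<integral>\<^sup>+z. ennreal (lyapunov m z) \<partial>pp_marina_step n r p \<gamma> Q f (x, g, s))
    \<le> ennreal (1 - \<gamma> * \<mu>) * ennreal (lyapunov m (x, g, s))"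
proof -
  define x' where "x' = x - \<gamma> *\<^sub>R g"
  define E where "E = (norm (g - grad F x))\<^sup>2 + (1 + \<omega>) * L\<^sup>2 / real r * (norm (x' - x))\<^sup>2"
  have E: "0 \<le> E"
    using \<omega>_pos unfolding E_def by (intro add_nonneg_nonneg mult_nonneg_nonneg divide_nonneg_nonneg) auto
  have \<gamma>p: "0 \<le> \<gamma> / p" using \<gamma> p by simp
  have a: "0 \<le> F y - m" for y using lower[of y] by simp
  let ?err = "\<lambda>q :: nat \<Rightarrow> real ^ 'd. ennreal ((norm (g + (1 / real r) *\<^sub>R (\<Sum>j<r. q j) - grad F x'))\<^sup>2)"
  have lyap: "ennreal (lyapunov m (x', g', s')) = ennreal (F x' - m) + ennreal (\<gamma> / p) * ennreal ((norm (g' - grad F x'))\<^sup>2)" for g' s'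
    using a \<gamma>p unfolding lyapunov_def fst_conv snd_conv
    by (simp only: ennreal_mult[symmetric] ennreal_plus mult_nonneg_nonneg zero_le_power2)
  have inner: "(\<integral>\<^sup>+q. ennreal (F x' - m) + ennreal (\<gamma> / p) * ?err q \<partial>msgs J x x')
     = ennreal (F x' - m) + ennreal (\<gamma> / p) * (\<integral>\<^sup>+q. ?err q \<partial>msgs J x x')" for J
    by (subst nn_integral_add) (auto simp: nn_integral_cmult prob_space.emeasure_space_1[OF prob_space_msgs])
  have "(\<integral>\<^sup>+J. \<integral>\<^sup>+q. ennreal (F x' - m) + ennreal (\<gamma> / p) * ?err q \<partial>msgs J x x' \<partial>measure_pmf (clients n r))
     = ennreal (F x' - m) + ennreal (\<gamma> / p) * (\<integral>\<^sup>+J. \<integral>\<^sup>+q. ?err q \<partial>msgs J x x' \<partial>measure_pmf (clients n r))"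
    unfolding inner by (subst nn_integral_add) (auto simp: nn_integral_cmult measure_pmf.emeasure_space_1)
  also have "\<dots> \<le> ennreal (F x' - m) + ennreal (\<gamma> / p) * ennreal E"
    unfolding E_def by (intro add_left_mono mult_left_mono nn_integral_estimator_error) auto
  also have "\<dots> = ennreal (F x' - m + \<gamma> / p * E)"
    using E a \<gamma>p by (simp only: ennreal_mult[symmetric] ennreal_plus mult_nonneg_nonneg)
  finally have err: "(\<integral>\<^sup>+J. \<integral>\<^sup>+q. ennreal (F x' - m) + ennreal (\<gamma> / p) * ?err q \<partial>msgs J x x' \<partial>measure_pmf (clients n r))
     \<le> ennreal (F x' - m + \<gamma> / p * E)" .
  \<comment> \<open>After a synchronization the estimator is exact, so that branch contributes the
    function gap alone.\<close>
  have "(\<integral>\<^sup>+z. ennreal (lyapunov m z) \<partial>pp_marina_step n r p \<gamma> Q f (x, g, s)) =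
    ennreal (F x' - m) * ennreal p +
    (\<integral>\<^sup>+J. \<integral>\<^sup>+q. ennreal (F x' - m) + ennreal (\<gamma> / p) * ?err q \<partial>msgs J x x' \<partial>measure_pmf (clients n r)) * ennreal (1 - p)"
    by (subst nn_integral_pp_marina_step[OF _ x'_def]) (simp_all add: lyap)
  also have "\<dots> \<le> ennreal (F x' - m) * ennreal p + ennreal (F x' - m + \<gamma> / p * E) * ennreal (1 - p)"
    by (intro add_left_mono mult_right_mono err) auto
  also have "\<dots> = ennreal ((F x' - m) * p) + ennreal ((F x' - m + \<gamma> / p * E) * (1 - p))"
    using p a E \<gamma>p by (simp only: ennreal_mult add_nonneg_nonneg mult_nonneg_nonneg diff_ge_0_iff_ge less_imp_le)
  also have "\<dots> = ennreal ((F x' - m) * p + (F x' - m + \<gamma> / p * E) * (1 - p))"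
    using p a E \<gamma>p by (intro ennreal_plus[symmetric] mult_nonneg_nonneg add_nonneg_nonneg) auto
  also have "\<dots> = ennreal (F x' - m + \<gamma> / p * (1 - p) * E)"
    by (rule arg_cong[where f = ennreal]) (simp add: algebra_simps)
  also have "\<dots> \<le> ennreal ((1 - \<gamma> * \<mu>) * lyapunov m (x, g, s))"
    unfolding E_def x'_def by (intro ennreal_leI real_lyapunov_step \<gamma> PL stepsize)
  also have "\<dots> = ennreal (1 - \<gamma> * \<mu>) * ennreal (lyapunov m (x, g, s))"
    using a \<gamma>p unfolding lyapunov_def fst_conv snd_conv
    by (intro ennreal_mult contraction_nonneg \<gamma> add_nonneg_nonneg mult_nonneg_nonneg) simp_all
  finally show ?thesis .
qed

section \<open>Iteration of the one-step bounds\<close>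

lemma pp_marina_in_prob_algebra: "pp_marina n r p \<gamma> Q f x0 k \<in> space (prob_algebra borel)"
proof (induction k)
  case 0
  then show ?case by (auto simp: space_prob_algebra intro: prob_space_return)
next
  case (Suc k)
  then show ?case
    using prob_space_bind'[OF _ pp_marina_step_kernel] sets_bind'[OF _ pp_marina_step_kernel]
    by (auto simp: space_prob_algebra)
qed

lemma prob_space_pp_marina: "prob_space (pp_marina n r p \<gamma> Q f x0 k)"
  and sets_pp_marina [measurable_cong]: "sets (pp_marina n r p \<gamma> Q f x0 k) = sets borel"
  using pp_marina_in_prob_algebra by (auto simp: space_prob_algebra)

lemma nn_integral_pp_marina_Suc:
  assumes "h \<in> borel_measurable borel"
  shows "(\<integral>\<^sup>+z. h z \<partial>pp_marina n r p \<gamma> Q f x0 (Suc k)) =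
    (\<integral>\<^sup>+z. \<integral>\<^sup>+w. h w \<partial>pp_marina_step n r p \<gamma> Q f z \<partial>pp_marina n r p \<gamma> Q f x0 k)"
  using assms measurable_prob_algebraD[OF pp_marina_step_kernel]
  by (simp add: nn_integral_bind[where B = borel] measurable_cong_sets[OF sets_pp_marina refl])

lemma nn_integral_pp_marina_lyapunov:
  assumes \<gamma>: "0 \<le> \<gamma>" "2 * \<mu> * \<gamma> \<le> p"
    and lower: "\<And>x. m \<le> F x"
    and PL: "\<And>x. 2 * \<mu> * (F x - m) \<le> (norm (grad F x))\<^sup>2"
    and stepsize: "L * \<gamma> + 2 * ((1 - p) / p * ((1 + \<omega>) / real r)) * (L * \<gamma>)\<^sup>2 \<le> 1"
  shows "(\<integral>\<^sup>+z. ennreal (lyapunov m z) \<partial>pp_marina n r p \<gamma> Q f x0 k) \<le> ennreal ((1 - \<gamma> * \<mu>) ^ k * (F x0 - m))"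
proof (induction k)
  \<comment> \<open>The method starts from the exact gradient: the initial error is zero and only
    the gap at \<open>x0\<close> remains.\<close>
  case 0
  then show ?case by (simp add: nn_integral_return lyapunov_def F[symmetric])
next
  case (Suc k)
  have q: "0 \<le> 1 - \<gamma> * \<mu>"
    using contraction_nonneg[OF \<gamma>] .
  have "(\<integral>\<^sup>+z. ennreal (lyapunov m z) \<partial>pp_marina n r p \<gamma> Q f x0 (Suc k)) =
    (\<integral>\<^sup>+z. \<integral>\<^sup>+w. ennreal (lyapunov m w) \<partial>pp_marina_step n r p \<gamma> Q f z \<partial>pp_marina n r p \<gamma> Q f x0 k)"
    by (rule nn_integral_pp_marina_Suc) measurable
  also have "\<dots> \<le> (\<integral>\<^sup>+z. ennreal (1 - \<gamma> * \<mu>) * ennreal (lyapunov m z) \<partial>pp_marina n r p \<gamma> Q f x0 k)"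
  proof (rule nn_integral_mono)
    fix z :: "(real ^ 'd) \<times> (real ^ 'd) \<times> real"
    show "(\<integral>\<^sup>+w. ennreal (lyapunov m w) \<partial>pp_marina_step n r p \<gamma> Q f z) \<le> ennreal (1 - \<gamma> * \<mu>) * ennreal (lyapunov m z)"
      using nn_integral_step_lyapunov[OF assms, of "fst z" "fst (snd z)" "snd (snd z)"] by simp
  qed
  also have "\<dots> = ennreal (1 - \<gamma> * \<mu>) * (\<integral>\<^sup>+z. ennreal (lyapunov m z) \<partial>pp_marina n r p \<gamma> Q f x0 k)"
    by (rule nn_integral_cmult) measurable
  also have "\<dots> \<le> ennreal (1 - \<gamma> * \<mu>) * ennreal ((1 - \<gamma> * \<mu>) ^ k * (F x0 - m))"
    by (intro mult_left_mono Suc.IH) auto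
  also have "\<dots> = ennreal ((1 - \<gamma> * \<mu>) ^ Suc k * (F x0 - m))"
    using q lower[of x0] by (subst ennreal_mult[symmetric]) (auto simp: mult.assoc)
  finally show ?case .
qed

lemma nn_integral_pp_marina_cost:
  "(\<integral>\<^sup>+z. ennreal \<bar>snd (snd z)\<bar> \<partial>pp_marina n r p \<gamma> Q f x0 k) \<le>
    ennreal (real CARD('d) * real n + real k * (p * (real CARD('d) * real n) + (1 - p) * (real r * expected_density Q)))"
proof (induction k)
  case 0
  \<comment> \<open>The gradients sent for the first estimator are the source of the summand without
    the factor \<open>k\<close>.\<close>
  have "(\<Sum>i=1..n. nnz (grad (f i) x0)) \<le> (\<Sum>i=1..n. real CARD('d))"
    by (intro sum_mono) simp
  moreover have "0 \<le> (\<Sum>i=1..n. nnz (grad (f i) x0))" by (intro sum_nonneg) simp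
  ultimately show ?case
    by (auto simp: nn_integral_return mult.commute intro!: ennreal_leI)
next
  case (Suc k)
  let ?C = "p * (real CARD('d) * real n) + (1 - p) * (real r * expected_density Q)"
  have C: "0 \<le> ?C"
    using p expected_density_pos[OF Q] by (intro add_nonneg_nonneg mult_nonneg_nonneg) auto
  have "(\<integral>\<^sup>+z. ennreal \<bar>snd (snd z)\<bar> \<partial>pp_marina n r p \<gamma> Q f x0 (Suc k)) =
    (\<integral>\<^sup>+z. \<integral>\<^sup>+w. ennreal \<bar>snd (snd w)\<bar> \<partial>pp_marina_step n r p \<gamma> Q f z \<partial>pp_marina n r p \<gamma> Q f x0 k)"
    by (rule nn_integral_pp_marina_Suc) measurable
  also have "\<dots> \<le> (\<integral>\<^sup>+z. ennreal \<bar>snd (snd z)\<bar> + ennreal ?C \<partial>pp_marina n r p \<gamma> Q f x0 k)"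
  proof (rule nn_integral_mono)
    fix z :: "(real ^ 'd) \<times> (real ^ 'd) \<times> real"
    show "(\<integral>\<^sup>+w. ennreal \<bar>snd (snd w)\<bar> \<partial>pp_marina_step n r p \<gamma> Q f z) \<le> ennreal \<bar>snd (snd z)\<bar> + ennreal ?C"
      using nn_integral_step_cost[of "fst z" "fst (snd z)" "snd (snd z)"] by simp
  qed
  also have "\<dots> = (\<integral>\<^sup>+z. ennreal \<bar>snd (snd z)\<bar> \<partial>pp_marina n r p \<gamma> Q f x0 k) + ennreal ?C"
    by (subst nn_integral_add) (auto simp: prob_space.emeasure_space_1[OF prob_space_pp_marina])
  also have "\<dots> \<le> ennreal (real CARD('d) * real n + real k * ?C) + ennreal ?C"
    by (intro add_right_mono Suc.IH)
  also have "\<dots> = ennreal (real CARD('d) * real n + real k * ?C + ?C)"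
    by (intro ennreal_plus[symmetric] add_nonneg_nonneg[OF _ mult_nonneg_nonneg[OF _ C]] C) simp_all
  also have "real CARD('d) * real n + real k * ?C + ?C = real CARD('d) * real n + real (Suc k) * ?C"
    by (simp add: distrib_right)
  finally show ?case .
qed

text \<open>The gap is the Lyapunov function without its nonnegative error term, and being
  nonnegative it equals its absolute value.\<close>

lemma pp_marina_gap:
  assumes \<gamma>: "0 \<le> \<gamma>" "2 * \<mu> * \<gamma> \<le> p"
    and lower: "\<And>x. m \<le> F x"
    and PL: "\<And>x. 2 * \<mu> * (F x - m) \<le> (norm (grad F x))\<^sup>2"
    and stepsize: "L * \<gamma> + 2 * ((1 - p) / p * ((1 + \<omega>) / real r)) * (L * \<gamma>)\<^sup>2 \<le> 1"
  shows "integrable (pp_marina n r p \<gamma> Q f x0 k) (\<lambda>z. F (fst z) - m)"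
    and "(\<integral>z. F (fst z) - m \<partial>pp_marina n r p \<gamma> Q f x0 k) \<le> (1 - \<gamma> * \<mu>) ^ k * (F x0 - m)"
proof -
  have meas: "(\<lambda>z. F (fst z) - m) \<in> borel_measurable (pp_marina n r p \<gamma> Q f x0 k)"
    by measurable
  have "(\<integral>\<^sup>+z. ennreal \<bar>F (fst z) - m\<bar> \<partial>pp_marina n r p \<gamma> Q f x0 k) \<le>
      (\<integral>\<^sup>+z. ennreal (lyapunov m z) \<partial>pp_marina n r p \<gamma> Q f x0 k)"
    using \<gamma>(1) p lower by (intro nn_integral_mono ennreal_leI) (simp add: lyapunov_def)
  also have "\<dots> \<le> ennreal ((1 - \<gamma> * \<mu>) ^ k * (F x0 - m))"
    by (rule nn_integral_pp_marina_lyapunov[OF assms])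
  finally have le: "(\<integral>\<^sup>+z. ennreal \<bar>F (fst z) - m\<bar> \<partial>pp_marina n r p \<gamma> Q f x0 k) \<le> \<dots>" .
  have "0 \<le> (1 - \<gamma> * \<mu>) ^ k * (F x0 - m)"
    using contraction_nonneg[OF \<gamma>] lower[of x0] by simp
  from integral_le_of_nn_integral_le[OF meas le this]
  show "integrable (pp_marina n r p \<gamma> Q f x0 k) (\<lambda>z. F (fst z) - m)"
    and "(\<integral>z. F (fst z) - m \<partial>pp_marina n r p \<gamma> Q f x0 k) \<le> (1 - \<gamma> * \<mu>) ^ k * (F x0 - m)" .
qed

lemma pp_marina_cost:
  shows "integrable (pp_marina n r p \<gamma> Q f x0 k) (\<lambda>z. snd (snd z))"
    and "(\<integral>z. snd (snd z) \<partial>pp_marina n r p \<gamma> Q f x0 k) \<le>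
      real CARD('d) * real n + real k * (p * (real CARD('d) * real n) + (1 - p) * (real r * expected_density Q))"
proof -
  have meas: "(\<lambda>z. snd (snd z)) \<in> borel_measurable (pp_marina n r p \<gamma> Q f x0 k)"
    by measurable
  have "0 \<le> real CARD('d) * real n + real k * (p * (real CARD('d) * real n) + (1 - p) * (real r * expected_density Q))"
    using p expected_density_pos[OF Q] by (intro add_nonneg_nonneg mult_nonneg_nonneg) auto
  from integral_le_of_nn_integral_le[OF meas nn_integral_pp_marina_cost this]
  show "integrable (pp_marina n r p \<gamma> Q f x0 k) (\<lambda>z. snd (snd z))"
    and "(\<integral>z. snd (snd z) \<partial>pp_marina n r p \<gamma> Q f x0 k) \<le>
      real CARD('d) * real n + real k * (p * (real CARD('d) * real n) + (1 - p) * (real r * expected_density Q))" .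
qed

end

section \<open>Stepsize and complexity\<close>

text \<open>With \<open>t = L * \<gamma>\<close> and \<open>u = sqrt (2 * A)\<close> the hypothesis
  reads \<open>t * (1 + u) \<le> 1\<close>, that is \<open>t * u \<le> 1 - t\<close>. Squaring gives
  the claim because \<open>(1 - t)\<^sup>2 \<le> 1 - t\<close> for \<open>t\<close> between 0 and
  1.\<close>

lemma stepsize_bound:
  fixes L \<gamma> A :: real
  assumes "0 < L" "0 \<le> A" "0 \<le> \<gamma>" and le: "\<gamma> \<le> 1 / (L * (1 + sqrt (2 * A)))"
  shows "L * \<gamma> + 2 * A * (L * \<gamma>)\<^sup>2 \<le> 1"
proof -
  define t u where "t = L * \<gamma>" and "u = sqrt (2 * A)"
  have u: "0 \<le> u" "u\<^sup>2 = 2 * A" and t: "0 \<le> t"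
    using assms by (auto simp: u_def t_def)
  have "\<gamma> * (L * (1 + u)) \<le> 1"
    using le u \<open>0 < L\<close> unfolding u_def[symmetric] by (subst (asm) pos_le_divide_eq) auto
  then have tu: "t * u \<le> 1 - t" by (simp add: t_def algebra_simps)
  then have "t \<le> 1" using u(1) t mult_nonneg_nonneg[of t u] by linarith
  have "(t * u)\<^sup>2 \<le> (1 - t)\<^sup>2"
    using tu u(1) t by (intro power_mono) auto
  also have "\<dots> \<le> 1 - t"
    using \<open>t \<le> 1\<close> t mult_nonneg_nonneg[of t "1 - t"] by (simp add: power2_eq_square algebra_simps)
  finally show ?thesis
    by (simp add: t_def[symmetric] u(2) power_mult_distrib mult.commute)
qed

text \<open>This converts the lower bound on the stepsize into an iteration scale for
  \<open>1 / (\<gamma> * \<mu>)\<close>. The constant 2 covers the estimate of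
  \<open>sqrt (2 * A)\<close> by \<open>2 * sqrt A\<close> in one branch of the minimum and is the 2
  of \<open>p / (2 * \<mu>)\<close> in the other; \<open>1 / c\<close> is the loss from a stepsize
  below the largest admissible one.\<close>

lemma rate_bound:
  fixes L \<mu> A p \<gamma> c :: real
  assumes "0 < L" "0 < \<mu>" "0 \<le> A" "0 < p" "0 < c"
    and \<gamma>: "c * min (1 / (L * (1 + sqrt (2 * A)))) (p / (2 * \<mu>)) \<le> \<gamma>"
  shows "1 \<le> 2 / c * max (1 / p) (L / \<mu> * (1 + sqrt A)) * (\<gamma> * \<mu>)"
proof -
  define M where "M = max (1 / p) (L / \<mu> * (1 + sqrt A))"
  define b where "b = min (1 / (L * (1 + sqrt (2 * A)))) (p / (2 * \<mu>))"
  have M: "1 / p \<le> M" "L / \<mu> * (1 + sqrt A) \<le> M" and M0: "0 < M"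
    using assms by (auto simp: M_def less_max_iff_disj)
  have s: "0 \<le> sqrt A" "sqrt 2 \<le> 2" using assms real_sqrt_le_iff[of 2 4] by auto
  have "1 \<le> 2 * M * (b * \<mu>)"
  proof (cases "1 / (L * (1 + sqrt (2 * A))) \<le> p / (2 * \<mu>)")
    case True
    have "sqrt (2 * A) \<le> 2 * sqrt A"
      unfolding real_sqrt_mult using s by (intro mult_right_mono)
    then have "1 + sqrt (2 * A) \<le> 2 * (1 + sqrt A)" by simp
    then have "1 \<le> 2 * (1 + sqrt A) / (1 + sqrt (2 * A))"
      using assms by (subst pos_le_divide_eq) (auto intro: add_pos_nonneg)
    also have "\<dots> = 2 * (L / \<mu> * (1 + sqrt A)) * (b * \<mu>)"
      using True assms by (simp add: b_def min_def)
    also have "\<dots> \<le> 2 * M * (b * \<mu>)"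
      using M assms by (intro mult_right_mono mult_left_mono) (auto simp: b_def)
    finally show ?thesis .
  next
    case False
    then have "1 = 2 * (1 / p) * (b * \<mu>)"
      using assms by (simp add: b_def min_def)
    also have "\<dots> \<le> 2 * M * (b * \<mu>)"
      using M assms by (intro mult_right_mono mult_left_mono) (auto simp: b_def)
    finally show ?thesis .
  qed
  also have "\<dots> = 2 / c * M * ((c * b) * \<mu>)"
    using assms by simp
  also have "\<dots> \<le> 2 / c * M * (\<gamma> * \<mu>)"
    using \<gamma> M0 assms unfolding b_def[symmetric] by (intro mult_left_mono mult_right_mono) auto
  finally show ?thesis unfolding M_def .
qed

text \<open>Since \<open>1 - a \<le> exp (- a)\<close>, the power is at most
  \<open>exp (- (real k * a))\<close>, and \<open>B * a \<ge> 1\<close> makes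
  \<open>real k * a\<close> at least the logarithm.\<close>

lemma geometric_le_of_log:
  fixes a B \<Delta> \<epsilon> :: real
  assumes a: "0 \<le> a" "a \<le> 1" and B: "1 \<le> B * a" and \<epsilon>: "0 < \<epsilon>" and \<Delta>: "0 \<le> \<Delta>"
    and k: "B * ln (\<Delta> / \<epsilon>) \<le> real k"
  shows "(1 - a) ^ k * \<Delta> \<le> \<epsilon>"
proof (cases "\<Delta> \<le> \<epsilon>")
  \<comment> \<open>Here the logarithm may be nonpositive, or a mere default value if
    \<open>\<Delta> = 0\<close>. Every \<open>k\<close> will do, since the power is at most
    1.\<close>
  case True
  have "(1 - a) ^ k * \<Delta> \<le> 1 * \<Delta>"
    using a \<Delta> by (intro mult_right_mono power_le_one) auto
  then show ?thesis using True by simp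
next
  case False
  then have ln: "0 \<le> ln (\<Delta> / \<epsilon>)" and pos: "0 < \<Delta> / \<epsilon>" using \<epsilon> by auto
  have "1 * ln (\<Delta> / \<epsilon>) \<le> (B * a) * ln (\<Delta> / \<epsilon>)"
    by (rule mult_right_mono[OF B ln])
  also have "\<dots> \<le> a * real k"
    using mult_left_mono[OF k a(1)] by (simp add: ac_simps)
  finally have *: "ln (\<Delta> / \<epsilon>) \<le> real k * a" by (simp add: mult.commute)
  have "(1 - a) ^ k \<le> exp (- a) ^ k"
    using a exp_ge_add_one_self[of "- a"] by (intro power_mono) auto
  also have "\<dots> = exp (- (real k * a))"
    by (simp add: exp_of_nat_mult[symmetric])
  also have "\<dots> \<le> exp (- ln (\<Delta> / \<epsilon>))"
    using * by simp
  also have "\<dots> = \<epsilon> / \<Delta>"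
    using pos by (simp add: exp_minus)
  finally have "(1 - a) ^ k * \<Delta> \<le> \<epsilon> / \<Delta> * \<Delta>"
    using \<Delta> by (rule mult_right_mono)
  then show ?thesis using False \<epsilon> by simp
qed

text \<open>Multiplying the iteration scale by the cost scale \<open>z * r\<close> of a round turns
  it term by term into the communication scale; rounding \<open>K\<close> up costs at most one more
  round.\<close>

lemma communication_bound:
  fixes L \<mu> \<omega> z r N c l :: real
  assumes z: "0 < z" "0 < r" "z * r \<le> N" and c: "0 < c" "c \<le> 1" and l: "0 \<le> l" and L: "0 \<le> L" "0 < \<mu>" "0 < \<omega>"
  shows "N + real (nat \<lceil>2 / c * (max (N / (z * r)) (L / \<mu> * (1 + sqrt ((1 + \<omega>) / r * (N / (z * r) - 1)))) * l)\<rceil>) * (2 * (z * r))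
    \<le> 4 / c * (N + max N (L / \<mu> * (z * r + sqrt ((1 + \<omega>) * z * (N - z * r)))) * l)"
proof -
  define M where "M = max (N / (z * r)) (L / \<mu> * (1 + sqrt ((1 + \<omega>) / r * (N / (z * r) - 1))))"
  have zr: "0 < z * r" using z by simp
  have N: "0 < N" using zr z by linarith
  have "0 < N / (z * r)" using N zr by simp
  then have "0 \<le> M" by (simp add: M_def le_max_iff_disj)
  then have "0 \<le> 2 / c * (M * l)" using c l by simp
  then have ceil: "real (nat \<lceil>2 / c * (M * l)\<rceil>) \<le> 2 / c * (M * l) + 1" by linarith
  \<comment> \<open>The factor enters the root as its square, which clears both denominators
    there.\<close>
  have "z * r * sqrt ((1 + \<omega>) / r * (N / (z * r) - 1)) = sqrt ((z * r)\<^sup>2 * ((1 + \<omega>) / r * (N / (z * r) - 1)))"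
    unfolding real_sqrt_mult[of "(z * r)\<^sup>2"] using zr by simp
  also have "(z * r)\<^sup>2 * ((1 + \<omega>) / r * (N / (z * r) - 1)) = (1 + \<omega>) * z * (N - z * r)"
    using z by (simp add: field_simps power2_eq_square)
  finally have "z * r * (L / \<mu> * (1 + sqrt ((1 + \<omega>) / r * (N / (z * r) - 1)))) =
      L / \<mu> * (z * r + sqrt ((1 + \<omega>) * z * (N - z * r)))"
    by (simp add: algebra_simps)
  moreover have "z * r * (N / (z * r)) = N" using z by simp
  ultimately have zrM: "z * r * M = max N (L / \<mu> * (z * r + sqrt ((1 + \<omega>) * z * (N - z * r))))"
    unfolding M_def using zr by (simp only: max_mult_distrib_left if_True less_imp_le)
  have "N + real (nat \<lceil>2 / c * (M * l)\<rceil>) * (2 * (z * r)) \<le> N + (2 / c * (M * l) + 1) * (2 * (z * r))"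
    using ceil zr by (intro add_left_mono mult_right_mono) auto
  also have "\<dots> = N + 2 * (z * r) + 4 / c * (z * r * M * l)"
    by (simp add: algebra_simps)
  also have "\<dots> \<le> 4 / c * N + 4 / c * (z * r * M * l)"
  proof -
    \<comment> \<open>The extra round costs \<open>2 * (z * r) \<le> 2 * N\<close>, so the part free
      of \<open>l\<close> is at most \<open>3 * N\<close>.\<close>
    have "4 * N \<le> 4 / c * N" using c N by (intro mult_right_mono) (auto simp: pos_le_divide_eq)
    then show ?thesis using z N by linarith
  qed
  finally show ?thesis
    unfolding M_def[symmetric] zrM[symmetric] by (simp only: distrib_left)
qed

text \<open>The O-bounds appear with explicit constants \<open>2 / c\<close> and
  \<open>4 / c\<close>. The number \<open>c\<close> expresses that the stepsize is of the order of
  its upper limit, without which no rate could follow from an upper bound on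
  \<open>\<gamma>\<close>. The cost bound is confined to \<open>\<epsilon> \<le> \<Delta>0\<close>,
  where the logarithm is nonnegative, and integrability is asserted because a Bochner integral could
  otherwise be 0 by convention.\<close>

theorem corollaryE2:
  fixes f :: "nat \<Rightarrow> real ^ 'd \<Rightarrow> real" and F :: "real ^ 'd \<Rightarrow> real"
    and Q :: "real ^ 'd \<Rightarrow> (real ^ 'd) measure"
    and Ls :: "nat \<Rightarrow> real" and x0 xstar :: "real ^ 'd"
    and n r :: nat
    and d L \<mu> \<omega> \<zeta> p \<gamma> \<gamma>max \<Delta>0 flow \<epsilon> c :: real
  assumes r: "1 \<le> r" "r \<le> n"
    and d: "d = real CARD('d)"
    and F: "F = average n f"
    and lower: "\<forall>x. F x \<ge> flow"
    and smooth: "\<forall>i\<in>{1..n}. smooth_with (Ls i) (f i)"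
    and xstar: "is_arg_min F (\<lambda>_. True) xstar"
    and PL: "\<mu> > 0" "polyak_lojasiewicz \<mu> F xstar"
    and L: "L = sqrt (1 / real n * (\<Sum>i=1..n. (Ls i)\<^sup>2))"
    and \<Delta>0: "\<Delta>0 = F x0 - F xstar"
    and Q: "quantization \<omega> Q"
    and \<zeta>: "\<zeta> = expected_density Q"
    and p: "p = \<zeta> * r / (d * n)"
    and \<gamma>max: "\<gamma>max = min (1 / (L * (1 + sqrt (2 * (1 + \<omega>) / r * (d * n / (\<zeta> * r) - 1)))))
                           (p / (2 * \<mu>))"
    and \<gamma>: "\<gamma> \<le> \<gamma>max" "c * \<gamma>max \<le> \<gamma>" "0 < c" "c \<le> 1"
    and \<epsilon>: "\<epsilon> > 0"
  shows "let M = max (d * n / (\<zeta> * r))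
                     (L / \<mu> * (1 + sqrt ((1 + \<omega>) / r * (d * n / (\<zeta> * r) - 1))));
             K = nat \<lceil>2 / c * (M * ln (\<Delta>0 / \<epsilon>))\<rceil>;
             P = pp_marina n r p \<gamma> Q f x0 K
         in integrable P (\<lambda>(x, g, s). F x - F xstar) \<and>
            (\<integral>(x, g, s). F x - F xstar \<partial>P) \<le> \<epsilon> \<and>
            integrable P (\<lambda>(x, g, s). s) \<and>
            (\<epsilon> \<le> \<Delta>0 \<longrightarrow>
             (\<integral>(x, g, s). s \<partial>P) \<le>
               4 / c * (d * n + max (d * n) (L / \<mu> * (\<zeta> * r + sqrt ((1 + \<omega>) * \<zeta> * (d * n - \<zeta> * r))))
                                 * ln (\<Delta>0 / \<epsilon>)))"
proof -
  define M where "M = max (d * n / (\<zeta> * r)) (L / \<mu> * (1 + sqrt ((1 + \<omega>) / r * (d * n / (\<zeta> * r) - 1))))"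
  define K where "K = nat \<lceil>2 / c * (M * ln (\<Delta>0 / \<epsilon>))\<rceil>"
  define P where "P = pp_marina n r p \<gamma> Q f x0 K"
  \<comment> \<open>As \<open>1 / p = d * n / (\<zeta> * r)\<close>, this is the quantity under the
    root in the iteration bound, and twice it stands under the root in the stepsize.\<close>
  define A where "A = (1 - p) / p * ((1 + \<omega>) / real r)"
  have rn: "0 < real r" "real r \<le> real n" and d0: "0 < d" and \<zeta>0: "0 < \<zeta>" "\<zeta> \<le> d" and \<omega>: "0 < \<omega>"
    using r expected_density_pos[OF Q] expected_density_le[OF Q] Q unfolding \<zeta> d quantization_def by auto
  have dn: "0 < d * n" and \<zeta>r: "0 < \<zeta> * r" "\<zeta> * r \<le> d * n"
    using rn d0 \<zeta>0 by (auto intro: mult_mono)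
  have p01: "0 < p" "p \<le> 1"
    using dn \<zeta>r unfolding p by auto
  have inv_p: "d * n / (\<zeta> * r) = 1 / p" and p_dn: "p * (d * n) = \<zeta> * r"
    using dn \<zeta>r unfolding p by auto
  have A: "0 \<le> A" "(1 + \<omega>) / r * (d * n / (\<zeta> * r) - 1) = A"
      "2 * (1 + \<omega>) / r * (d * n / (\<zeta> * r) - 1) = 2 * A"
    using p01 rn \<omega> mult_nonneg_nonneg[of "(1 - p) / p" "(1 + \<omega>) / real r"]
    unfolding A_def inv_p by (simp_all add: diff_divide_distrib)
  note setting = r p01 Q smooth F L
  have L0: "0 \<le> L" unfolding L by (simp add: sum_nonneg)
  have min: "F xstar \<le> F x" for x
    using xstar unfolding is_arg_min_def by (metis not_le)
  have \<Delta>: "0 \<le> \<Delta>0" using min[of x0] unfolding \<Delta>0 by simp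
  note smoothF = average_smooth_with(1)[OF smooth, folded F L]
  have gap: "integrable P (\<lambda>z. F (fst z) - F xstar) \<and> (\<integral>z. F (fst z) - F xstar \<partial>P) \<le> \<epsilon>"
  \<comment> \<open>For \<open>L = 0\<close> the quotient in \<open>\<gamma>max\<close> is 0 by
    convention, so \<open>\<gamma> = 0\<close> and the iterates do not move; the claim then holds
    because \<open>F\<close> is constant.\<close>
  proof (cases "L = 0")
    case True
    then have "F x = F xstar" for x
      using smooth_with_0_PL_const[OF smoothF _ min PL(2,1)] by simp
    then have "(\<lambda>z :: (real ^ 'd) \<times> (real ^ 'd) \<times> real. F (fst z) - F xstar) = (\<lambda>_. 0)" by auto
    then show ?thesis using \<epsilon> by simp
  next
    case False
    then have L_pos: "0 < L" using L0 by simp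
    have \<gamma>max': "\<gamma>max = min (1 / (L * (1 + sqrt (2 * A)))) (p / (2 * \<mu>))"
      unfolding \<gamma>max A(3) ..
    have "0 \<le> \<gamma>max" using L_pos A(1) p01 PL(1) unfolding \<gamma>max' by simp
    then have \<gamma>0: "0 \<le> \<gamma>" using \<gamma>(2,3) by (meson mult_nonneg_nonneg less_imp_le order_trans)
    have \<gamma>1: "\<gamma> \<le> 1 / (L * (1 + sqrt (2 * A)))" and "\<gamma> \<le> p / (2 * \<mu>)"
      using \<gamma>(1) unfolding \<gamma>max' by auto
    then have \<gamma>\<mu>: "2 * \<mu> * \<gamma> \<le> p"
      using PL(1) by (simp add: field_simps)
    have PL': "2 * \<mu> * (F x - F xstar) \<le> (norm (grad F x))\<^sup>2" for x
      using PL(2) unfolding polyak_lojasiewicz_def by blast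
    note gap = pp_marina_gap[OF setting \<gamma>0 \<gamma>\<mu> min PL' stepsize_bound[OF L_pos A(1) \<gamma>0 \<gamma>1, unfolded A_def],
        of x0 K, folded P_def]
    note gap(2)
    also have "(1 - \<gamma> * \<mu>) ^ K * (F x0 - F xstar) \<le> \<epsilon>"
    proof (intro geometric_le_of_log[where B = "2 / c * M"])
      show "0 \<le> \<gamma> * \<mu>" "\<gamma> * \<mu> \<le> 1"
        using \<gamma>0 PL(1) contraction_nonneg[OF setting \<gamma>0 \<gamma>\<mu>] by auto
      show "1 \<le> 2 / c * M * (\<gamma> * \<mu>)"
        unfolding M_def inv_p A(2)[unfolded inv_p]
        using rate_bound[OF L_pos PL(1) A(1) p01(1) \<gamma>(3) \<gamma>(2)[unfolded \<gamma>max']] .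
      show "2 / c * M * ln ((F x0 - F xstar) / \<epsilon>) \<le> real K"
        unfolding K_def \<Delta>0 by (simp only: mult.assoc real_nat_ceiling_ge)
    qed (use \<epsilon> min in auto)
    finally show ?thesis
      using gap(1) by simp
  qed
  have cost: "integrable P (\<lambda>z. snd (snd z))"
    "(\<integral>z. snd (snd z) \<partial>P) \<le> d * n + K * (p * (d * n) + (1 - p) * (r * \<zeta>))"
    using pp_marina_cost[OF setting, of \<gamma> x0 K, folded P_def d \<zeta>] .
  have "(\<integral>z. snd (snd z) \<partial>P) \<le> 4 / c * (d * n + max (d * n) (L / \<mu> * (\<zeta> * r + sqrt ((1 + \<omega>) * \<zeta> * (d * n - \<zeta> * r)))) * ln (\<Delta>0 / \<epsilon>))"
    if "\<epsilon> \<le> \<Delta>0"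
  proof -
    \<comment> \<open>The choice of \<open>p\<close> balances the two kinds of round:
      \<open>p * (d * n)\<close> is exactly \<open>\<zeta> * r\<close>, and the quantized rounds add
      at most the same amount.\<close>
    have "p * (d * n) + (1 - p) * (r * \<zeta>) \<le> 2 * (\<zeta> * r)"
      using p01 \<zeta>r mult_nonneg_nonneg[of p "\<zeta> * r"] unfolding p_dn by (simp add: algebra_simps)
    then have "(\<integral>z. snd (snd z) \<partial>P) \<le> d * n + K * (2 * (\<zeta> * r))"
      using cost(2) mult_left_mono[of _ _ "real K"] by (meson add_left_mono of_nat_0_le_iff order_trans)
    also have "\<dots> \<le> 4 / c * (d * n + max (d * n) (L / \<mu> * (\<zeta> * r + sqrt ((1 + \<omega>) * \<zeta> * (d * n - \<zeta> * r)))) * ln (\<Delta>0 / \<epsilon>))"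
      unfolding K_def M_def using that \<epsilon> rn \<zeta>0 \<zeta>r \<gamma>(3,4) L0 PL(1) \<omega> by (intro communication_bound) auto
    finally show ?thesis .
  qed
  then show ?thesis
    using gap cost(1)
    by (simp only: Let_def case_prod_unfold M_def[symmetric] K_def[symmetric] P_def[symmetric]) blast
qed

end
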